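(* For each $n$, let $X_1,\ldots,X_n$ be a random sample from $f(x;\theta)$ in the natural exponential family described in the context, with $\theta$ constrained to $\mathcal{C}_1=\{\theta:\theta\ge d\}$, and suppose the true value of $\theta$ is $\theta_{0,n}=d+\tau n^{-1/2}$, where $\tau\ge 0$ is a fixed local parameter not depending on $n$. Let $\sigma_0^2=b''(\psi_0)$ with $\psi_0=(b')^{-1}(d)$ and $\sigma_0>0$. Let $\alpha_1,\alpha_2\in(0,0.5)$, and let $[q^*_{\alpha_1},q^*_{1-\alpha_2}]$ be the parametric bootstrap percentile confidence interval for $\theta$ defined in the context. Then, as $n\to\infty$, $$\mathrm{pr}\left(\theta_{0,n}\in[q^*_{\alpha_1},q^*_{1-\alpha_2}]\right)\to\begin{cases}1-\alpha_1-\alpha_2, & \tau>\Phi^{-1}(1-\alpha_2)\,\sigma_0,\\ 1-\alpha_1, & \tau<\Phi^{-1}(1-\alpha_2)\,\sigma_0.\end{cases}$$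
   Context: Natural exponential family: $f(x;\theta)=a(x)\exp\{\psi x-b(\psi)\}$ is a probability density function or probability mass function, where $\psi$ is the natural parameter, ranging over an open interval, and $b$ is twice continuously differentiable with $b''(\psi)>0$. The mean parameter is $\theta=E(X_1)=b'(\psi)$ and the variance is $b''(\psi)$. Let $M$ be the range of $b'$ (the set of possible means); the fixed boundary $d$ lies in $M$, so $(b')^{-1}(d)$ makes sense and $\theta_{0,n}\in M$ for all large $n$. Estimator: $\bar X_n=\sum_{i=1}^n X_i/n$, and the maximum likelihood estimator of $\theta$ subject to $\theta\ge d$ is $\hat\theta_n=\max(\bar X_n,d)$. Bootstrap: given $\hat\theta_n$, let $X_1^*,\ldots,X_n^*$ be a random sample from $f(x;\hat\theta_n)$, let $\bar X_n^*=\sum_{i=1}^n X_i^*/n$ and $\hat\theta_n^*=\max(\bar X_n^*,d)$. Let $G_n^*(x;\hat\theta_n)=\mathrm{pr}(\hat\theta_n^*\le x\mid\hat\theta_n)$ be the bootstrap distribution function, and let $q^*_\alpha=\inf\{x:G_n^*(x;\hat\theta_n)\ge\alpha\}$ be its $\alpha$-quantile. On the event $\hat\theta_n\notin M$ (where $f(x;\hat\theta_n)$ is not defined) the bootstrap quantities may be defined arbitrarily. $\mathrm{pr}(\cdot)$ denotes probability under $f(x;\theta_{0,n})$, and $\Phi$ is the standard normal cumulative distribution function. *)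

theory Defs
  imports "HOL-Probability.Probability"
begin

(* Counting measure on the Borel sets of the reals: densities with respect to it are the
   probability mass functions of discrete real random variables (their support is
   automatically countable, because the masses are summable). *)
definition counting_borel :: "real measure" where
  "counting_borel = distr (count_space UNIV) borel (\<lambda>x. x)"

definition nef_density :: "(real \<Rightarrow> real) \<Rightarrow> (real \<Rightarrow> real) \<Rightarrow> real \<Rightarrow> real \<Rightarrow> real" where
  "nef_density a b \<psi> x = a x * exp (\<psi> * x - b \<psi>)"

definition nef_dist :: "real measure \<Rightarrow> (real \<Rightarrow> real) \<Rightarrow> (real \<Rightarrow> real) \<Rightarrow> real \<Rightarrow> real measure" where
  "nef_dist \<mu> a b \<psi> = density \<mu> (\<lambda>x. ennreal (nef_density a b \<psi> x))"

locale natural_exponential_family =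
  fixes \<mu> :: "real measure" and a b :: "real \<Rightarrow> real" and \<Psi> :: "real set"
  assumes pdf_or_pmf: "\<mu> = lborel \<or> \<mu> = counting_borel"
    and a_measurable: "a \<in> borel_measurable borel"
    and a_nonneg: "\<And>x. a x \<ge> 0"
    and param_space: "open \<Psi>" "is_interval \<Psi>" "\<Psi> \<noteq> {}"
    and normalized: "\<And>\<psi>. \<psi> \<in> \<Psi> \<Longrightarrow> prob_space (nef_dist \<mu> a b \<psi>)"
    and b_C2: "b differentiable_on \<Psi>" "deriv b differentiable_on \<Psi>"
      "continuous_on \<Psi> (deriv (deriv b))"
    and b''_pos: "\<And>\<psi>. \<psi> \<in> \<Psi> \<Longrightarrow> deriv (deriv b) \<psi> > 0"

definition mean_space :: "(real \<Rightarrow> real) \<Rightarrow> real set \<Rightarrow> real set" where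
  "mean_space b \<Psi> = deriv b ` \<Psi>"

(* (b')^{-1}(theta), meaningful for theta in mean_space b \<Psi>; the inverse is unique since
   b'' > 0 makes b' strictly increasing on \<Psi>. *)
definition natural_param :: "(real \<Rightarrow> real) \<Rightarrow> real set \<Rightarrow> real \<Rightarrow> real" where
  "natural_param b \<Psi> \<theta> = the_inv_into \<Psi> (deriv b) \<theta>"

(* The law with density f(x; theta) in the mean parametrization. *)
definition nef_mean_dist ::
    "real measure \<Rightarrow> (real \<Rightarrow> real) \<Rightarrow> (real \<Rightarrow> real) \<Rightarrow> real set \<Rightarrow> real \<Rightarrow> real measure" where
  "nef_mean_dist \<mu> a b \<Psi> \<theta> = nef_dist \<mu> a b (natural_param b \<Psi> \<theta>)"

definition random_sample :: "'a measure \<Rightarrow> nat \<Rightarrow> (nat \<Rightarrow> 'a \<Rightarrow> real) \<Rightarrow> real measure \<Rightarrow> bool" where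
  "random_sample P n X D \<longleftrightarrow>
     prob_space P \<and>
     prob_space.indep_vars P (\<lambda>_. borel) X {1..n} \<and>
     (\<forall>i\<in>{1..n}. distr P borel (X i) = D)"

definition sample_mean :: "nat \<Rightarrow> (nat \<Rightarrow> real) \<Rightarrow> real" where
  "sample_mean n x = (\<Sum>i=1..n. x i) / real n"

definition restricted_mle :: "real \<Rightarrow> nat \<Rightarrow> (nat \<Rightarrow> real) \<Rightarrow> real" where
  "restricted_mle d n x = max (sample_mean n x) d"

(* G_n^*(x; theta): the bootstrap sample, given that the estimate equals theta, is distributed
   as the n-fold product of f(.; theta). *)
definition bootstrap_cdf ::
    "real measure \<Rightarrow> (real \<Rightarrow> real) \<Rightarrow> (real \<Rightarrow> real) \<Rightarrow> real set \<Rightarrow> real \<Rightarrow> nat \<Rightarrow> real \<Rightarrow> real \<Rightarrow> real" where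
  "bootstrap_cdf \<mu> a b \<Psi> d n \<theta> x =
     (let P = PiM {1..n} (\<lambda>_. nef_mean_dist \<mu> a b \<Psi> \<theta>)
      in measure P {y \<in> space P. restricted_mle d n y \<le> x})"

(* The bootstrap alpha-quantile as a function of the estimate theta. Outside the mean space
   f(.; theta) is not defined, and the quantile takes the arbitrary value u n alpha theta. *)
definition bootstrap_quantile ::
    "(nat \<Rightarrow> real \<Rightarrow> real \<Rightarrow> real) \<Rightarrow> real measure \<Rightarrow> (real \<Rightarrow> real) \<Rightarrow> (real \<Rightarrow> real) \<Rightarrow> real set \<Rightarrow>
     real \<Rightarrow> nat \<Rightarrow> real \<Rightarrow> real \<Rightarrow> real" where
  "bootstrap_quantile u \<mu> a b \<Psi> d n \<alpha> \<theta> =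
     (if \<theta> \<in> mean_space b \<Psi> then Inf {x. bootstrap_cdf \<mu> a b \<Psi> d n \<theta> x \<ge> \<alpha>}
      else u n \<alpha> \<theta>)"

(* The inverse of the standard normal distribution function, meaningful on the open
   interval (0,1), which is its range. *)
definition std_normal_quantile :: "real \<Rightarrow> real" where
  "std_normal_quantile p = inv (cdf std_normal_distribution) p"

end

theory Submission
  imports Defs
begin

text \<open>
  Everything is measured on the scale of local natural parameters: write
  $\<psi> = \<psi>_0 + h/\<surd> n$. By a second-order expansion of $b$, the local mean
  $d + \<tau>/\<surd> n$ corresponds to $h \approx \<tau>/\<sigma>_0^2$, and the mean of a sample drawn with
  parameter $\<psi>_0 + h/\<surd> n$ is approximately normal with mean $d + \<sigma>_0^2 h/\<surd> n$ and
  standard deviation $\<sigma>_0/\<surd> n$ (\<open>cdf_mean_law_limit\<close>).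

  Let $\hat h \<ge> 0$ be the local parameter of the estimate. The bootstrap distribution function at the
  true mean is then about $\<Phi>(\<tau>/\<sigma>_0 - \<sigma>_0 \hat h)$. The lower end point of the
  interval is at most the true mean when this value is at least $\<alpha>_1$, that is when
  $\<sigma>_0 \hat h \<le> \<tau>/\<sigma>_0 + \<Phi>^{-1}(1 - \<alpha>_1)$; the upper end point is at least the
  true mean when this value is at most $1 - \<alpha>_2$, that is when
  $\<sigma>_0 \hat h \<ge> \<tau>/\<sigma>_0 - \<Phi>^{-1}(1 - \<alpha>_2)$. Without the truncation at $d$, the
  variable $\<sigma>_0 \hat h - \<tau>/\<sigma>_0$ would be asymptotically standard normal, so the two
  conditions would have limiting probabilities $1 - \<alpha>_1$ and $1 - \<alpha>_2$. The first threshold is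
  positive and the truncation does not affect it. The second one is positive exactly if
  $\<tau> > \<Phi>^{-1}(1 - \<alpha>_2)\,\<sigma>_0$; if it is negative, the second condition holds for every
  $\hat h \<ge> 0$ and the upper end point never misses. This is \<open>percentile_coverage_limit\<close>.

  Two devices keep the proof elementary. First, the normal limit under moving parameters is obtained
  from the central limit theorem at the single parameter $\<psi>_0$ by change of measure: the laws of
  the sample mean for different parameters are exponential tilts of each other (\<open>mean_law_tilt\<close>),
  and for $h \<ge> 0$ the tilt restricted to a left half line is bounded. The central limit theorem
  needs the mean $b'(\<psi>_0)$ and variance $b''(\<psi>_0)$, which are computed by differentiating the
  moment generating function (\<open>nef_moments\<close>). Second, the laws of the sample mean are stochastically
  increasing in the parameter (\<open>cdf_mean_law_antimono\<close>). Therefore the bootstrap quantiles are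
  monotone functions of the estimate, hence measurable, and limits at fixed values of $h$ suffice to
  locate the random end points: no convergence uniform in the estimate is required.
\<close>

section \<open>Exponential tilting\<close>

text \<open>The density $e^{\<delta> x - c}$ is increasing in $x$, so it crosses the level $1$ at most once.
If it is still below $1$ at \<open>t\<close>, tilting has removed mass from every part of \<open>{..t}\<close>; if it
is already above $1$ there, tilting has added mass to every part of \<open>{t<..}\<close>.\<close>

lemma cdf_exponential_tilt_le:
  fixes N N' :: "real measure"
  assumes N: "real_distribution N" and N': "real_distribution N'"
    and tilt: "N' = density N (\<lambda>x. ennreal (exp (\<delta> * x - c)))" and \<delta>: "0 \<le> \<delta>"
  shows "cdf N' t \<le> cdf N t"
proof -
  interpret N: real_distribution N by fact
  interpret N': real_distribution N' by fact
  have em: "emeasure N' A = (\<integral>\<^sup>+x. ennreal (exp (\<delta> * x - c)) * indicator A x \<partial>N)"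
    if "A \<in> sets borel" for A
    using that unfolding tilt by (subst emeasure_density) auto
  show ?thesis
  proof (cases "\<delta> * t - c \<le> 0")
    case True
    have "emeasure N' {..t} \<le> (\<integral>\<^sup>+x. indicator {..t} x \<partial>N)"
      unfolding em[of "{..t}", simplified]
    proof (rule nn_integral_mono)
      fix x
      have "x \<le> t \<Longrightarrow> \<delta> * x - c \<le> 0"
        using mult_left_mono[of x t \<delta>] \<delta> True by linarith
      then show "ennreal (exp (\<delta> * x - c)) * indicator {..t} x \<le> indicator {..t} x"
        by (auto split: split_indicator)
    qed
    then show ?thesis
      by (simp add: cdf_def N.emeasure_eq_measure N'.emeasure_eq_measure)
  next
    case False
    have "emeasure N' {t<..} \<ge> (\<integral>\<^sup>+x. indicator {t<..} x \<partial>N)"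
      unfolding em[of "{t<..}", simplified]
    proof (rule nn_integral_mono)
      fix x
      have "t < x \<Longrightarrow> 0 \<le> \<delta> * x - c"
        using mult_left_mono[of t x \<delta>] \<delta> False by linarith
      then show "indicator {t<..} x \<le> ennreal (exp (\<delta> * x - c)) * indicator {t<..} x"
        by (auto split: split_indicator)
    qed
    then have "measure N {t<..} \<le> measure N' {t<..}"
      by (simp add: N.emeasure_eq_measure N'.emeasure_eq_measure)
    moreover have "measure N {..t} = 1 - measure N {t<..}" "measure N' {..t} = 1 - measure N' {t<..}"
      using N.prob_compl[of "{t<..}"] N'.prob_compl[of "{t<..}"]
      by (simp_all add: Compl_eq_Diff_UNIV[symmetric])
    ultimately show ?thesis
      by (simp add: cdf_def)
  qed
qed

text \<open>This is what turns the tilt of one observation into the tilt of a sample.\<close>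

lemma density_PiM_product:
  fixes M :: "'i \<Rightarrow> 'a measure" and g :: "'i \<Rightarrow> 'a \<Rightarrow> real"
  assumes I: "finite I" and M: "\<And>i. prob_space (M i)"
    and D: "\<And>i. prob_space (density (M i) (\<lambda>x. ennreal (g i x)))"
    and g: "\<And>i. g i \<in> borel_measurable (M i)" "\<And>i x. 0 \<le> g i x"
  shows "density (PiM I M) (\<lambda>x. ennreal (\<Prod>i\<in>I. g i (x i))) =
         PiM I (\<lambda>i. density (M i) (\<lambda>x. ennreal (g i x)))"
proof -
  interpret M: product_prob_space M by (rule product_prob_spaceI) (rule M)
  interpret D: product_prob_space "\<lambda>i. density (M i) (\<lambda>x. ennreal (g i x))"
    by (rule product_prob_spaceI) (rule D)
  note g(1)[measurable]
  show ?thesis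
  proof (rule D.PiM_eqI[OF I])
    show "sets (density (Pi\<^sub>M I M) (\<lambda>x. ennreal (\<Prod>i\<in>I. g i (x i)))) =
        sets (Pi\<^sub>M I (\<lambda>i. density (M i) (\<lambda>x. ennreal (g i x))))"
      by (auto intro!: sets_PiM_cong)
    fix A assume A: "\<And>i. i \<in> I \<Longrightarrow> A i \<in> sets (density (M i) (\<lambda>x. ennreal (g i x)))"
    have [measurable]: "Pi\<^sub>E I A \<in> sets (PiM I M)"
      using A I by (intro sets_PiM_I_finite) auto
    have "emeasure (density (Pi\<^sub>M I M) (\<lambda>x. ennreal (\<Prod>i\<in>I. g i (x i)))) (Pi\<^sub>E I A) =
        (\<integral>\<^sup>+x. ennreal (\<Prod>i\<in>I. g i (x i)) * indicator (Pi\<^sub>E I A) x \<partial>PiM I M)"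
      by (subst emeasure_density) auto
    also have "\<dots> = (\<integral>\<^sup>+x. (\<Prod>i\<in>I. ennreal (g i (x i)) * indicator (A i) (x i)) \<partial>PiM I M)"
    proof (rule nn_integral_cong)
      fix x assume x: "x \<in> space (PiM I M)"
      have "indicator (Pi\<^sub>E I A) x = (\<Prod>i\<in>I. indicator (A i) (x i) :: ennreal)"
        using x I by (auto simp: indicator_def space_PiM PiE_iff prod_zero_iff)
      then show "ennreal (\<Prod>i\<in>I. g i (x i)) * indicator (Pi\<^sub>E I A) x =
          (\<Prod>i\<in>I. ennreal (g i (x i)) * indicator (A i) (x i))"
        by (simp add: prod.distrib prod_ennreal g(2))
    qed
    also have "\<dots> = (\<Prod>i\<in>I. \<integral>\<^sup>+x. ennreal (g i x) * indicator (A i) x \<partial>M i)"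
      using A by (intro M.product_nn_integral_prod I) auto
    also have "\<dots> = (\<Prod>i\<in>I. emeasure (density (M i) (\<lambda>x. ennreal (g i x))) (A i))"
      using A by (intro prod.cong refl) (subst emeasure_density, auto)
    finally show "emeasure (density (Pi\<^sub>M I M) (\<lambda>x. ennreal (\<Prod>i\<in>I. g i (x i)))) (Pi\<^sub>E I A) =
        (\<Prod>i\<in>I. emeasure (density (M i) (\<lambda>x. ennreal (g i x))) (A i))" .
  qed
qed

section \<open>Moments from the moment generating function\<close>

text \<open>One application of l'Hospital's rule leaves the difference quotient of \<open>f'\<close> at $0$, so a second
derivative at the base point suffices. The hypothesis \<open>f' 0 = 0\<close> means that the linear term has
been subtracted beforehand. This expansion serves three times: for $e^{hx}$ and the moment generating
function just below, and later for the log-partition function.\<close>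

lemma second_order_limit:
  fixes f f' :: "real \<Rightarrow> real"
  assumes \<delta>: "\<delta> > 0" and f: "\<And>x. \<bar>x\<bar> < \<delta> \<Longrightarrow> (f has_real_derivative f' x) (at x)"
    and f'0: "f' 0 = 0" and f'': "(f' has_real_derivative v) (at 0)"
  shows "((\<lambda>x. (f x - f 0) / x\<^sup>2) \<longlongrightarrow> v / 2) (at 0)"
proof (rule lhopital[where f' = f' and g' = "\<lambda>x. 2 * x"])
  have "isCont f 0" using DERIV_isCont[OF f[of 0]] \<delta> by simp
  then have "(f \<longlongrightarrow> f 0) (at 0)" by (simp add: isCont_def)
  then show "((\<lambda>x. f x - f 0) \<longlongrightarrow> 0) (at 0)" by (simp add: LIM_zero)
  show "((\<lambda>x::real. x\<^sup>2) \<longlongrightarrow> 0) (at 0)" by real_asymp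
  show "\<forall>\<^sub>F x::real in at 0. x\<^sup>2 \<noteq> 0" "\<forall>\<^sub>F x::real in at 0. 2 * x \<noteq> 0"
    by (auto simp: eventually_at_filter)
  have "\<forall>\<^sub>F x in at 0. \<bar>x\<bar> < \<delta>"
    unfolding eventually_at using \<delta> by (auto simp: dist_real_def)
  then show "\<forall>\<^sub>F x in at 0. ((\<lambda>x. f x - f 0) has_real_derivative f' x) (at x)"
    by eventually_elim (auto intro!: derivative_eq_intros f)
  show "\<forall>\<^sub>F x::real in at 0. ((\<lambda>x. x\<^sup>2) has_real_derivative 2 * x) (at x)"
    by (auto intro!: derivative_eq_intros always_eventually)
  have "((\<lambda>x. (f' x - f' 0) / x) \<longlongrightarrow> v) (at 0)"
    using f'' by (simp add: DERIV_def)
  from tendsto_divide[OF this tendsto_const[of 2]] show "((\<lambda>x. f' x / (2 * x)) \<longlongrightarrow> v / 2) (at 0)"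
    by (simp add: f'0 mult.commute)
qed

lemma abs_exp_minus_one_le: "\<bar>exp u - 1\<bar> \<le> \<bar>u\<bar> * exp \<bar>u\<bar>" for u :: real
proof -
  obtain t where t: "\<bar>t\<bar> \<le> \<bar>u\<bar>" "exp u = (\<Sum>m<1. u ^ m / fact m) + exp t / fact 1 * u ^ 1"
    using Maclaurin_exp_le[of u 1] by blast
  have "exp t \<le> exp \<bar>u\<bar>" using t(1) by simp
  then show ?thesis using t(2) mult_left_mono[of "exp t" "exp \<bar>u\<bar>" "\<bar>u\<bar>"]
    by (simp add: abs_mult mult.commute)
qed

lemma abs_exp_minus_linear_le: "\<bar>exp u - 1 - u\<bar> \<le> u\<^sup>2 * exp \<bar>u\<bar>" for u :: real
proof -
  obtain t where t: "\<bar>t\<bar> \<le> \<bar>u\<bar>" "exp u = (\<Sum>m<2. u ^ m / fact m) + exp t / fact 2 * u ^ 2"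
    using Maclaurin_exp_le[of u 2] by blast
  have "exp t \<le> exp \<bar>u\<bar>" using t(1) by simp
  then have "exp t / 2 \<le> exp \<bar>u\<bar>" using exp_ge_zero[of t] by linarith
  moreover have "exp u - 1 - u = u\<^sup>2 * (exp t / 2)"
    using t(2) by (simp add: numeral_2_eq_2)
  ultimately show ?thesis using mult_left_mono[of "exp t / 2" "exp \<bar>u\<bar>" "u\<^sup>2"]
    by (simp only: abs_mult) simp
qed

lemma exp_abs_le: "exp (\<delta> * \<bar>x\<bar>) \<le> exp (\<delta> * x) + exp (- \<delta> * x)" for \<delta> x :: real
  by (cases "x \<ge> 0") (auto simp: add_increasing add_increasing2)

text \<open>Differentiation of the moment generating function under the integral sign. For $0 < h \<le> \<epsilon>$
the difference quotient $(e^{hX} - 1)/h$ is at most $|X| e^{\<epsilon>|X|}$ in absolute value, and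
$(e^{hX} - 1 - hX)/h^2$ is at most $X^2 e^{\<epsilon>|X|}$. Both bounds are dominated by a multiple of
$e^{3\<epsilon>X} + e^{-3\<epsilon>X}$, which is integrable as soon as $3\<epsilon> < \<delta>$. Dominated convergence along one sequence of step widths then identifies the
moments with the derivatives of the integral, that is of $e^{K}$.\<close>

lemma (in prob_space) mean_variance_of_mgf:
  fixes X :: "'a \<Rightarrow> real" and K K' :: "real \<Rightarrow> real"
  assumes X[measurable]: "X \<in> borel_measurable M" and \<delta>: "\<delta> > 0"
    and int: "\<And>h. \<bar>h\<bar> < \<delta> \<Longrightarrow> integrable M (\<lambda>x. exp (h * X x))"
    and mgf: "\<And>h. \<bar>h\<bar> < \<delta> \<Longrightarrow> expectation (\<lambda>x. exp (h * X x)) = exp (K h)"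
    and K: "\<And>h. \<bar>h\<bar> < \<delta> \<Longrightarrow> (K has_real_derivative K' h) (at h)"
    and K': "(K' has_real_derivative v) (at 0)"
  shows "integrable M (\<lambda>x. (X x)\<^sup>2)" "expectation X = K' 0" "variance X = v"
proof -
  \<comment> \<open>the bound for the second moment costs three exponential factors, so 3 e must stay below \<delta>\<close>
  define e where "e = \<delta> / 4"
  define s where "s k = e / real (k + 1)" for k
  have e: "e > 0" using \<delta> by (simp add: e_def)
  have s: "0 < s k" "s k \<le> e" for k using e by (auto simp: s_def field_simps)
  have s_lim: "s \<longlonglongrightarrow> 0" unfolding s_def by real_asymp
  then have s_at: "filterlim s (at 0) sequentially"
    using s(1) by (auto simp: filterlim_at less_imp_neq[symmetric] intro!: always_eventually)
  have K0: "K 0 = 0" using mgf[of 0] \<delta> by (simp add: prob_space)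

  let ?B = "\<lambda>x. exp (3 * e * X x) + exp (- (3 * e) * X x)"
  have B: "integrable M ?B"
    using int[of "3 * e"] int[of "- (3 * e)"] \<delta> by (intro Bochner_Integration.integrable_add) (auto simp: e_def)
  have le_exp: "\<bar>X x\<bar> \<le> exp (e * \<bar>X x\<bar>) / e" for x
  proof -
    have "e * \<bar>X x\<bar> \<le> exp (e * \<bar>X x\<bar>)"
      using exp_ge_add_one_self[of "e * \<bar>X x\<bar>"] by linarith
    then show ?thesis using e by (simp add: field_simps)
  qed
  have sq_le: "(X x)\<^sup>2 * exp (e * \<bar>X x\<bar>) \<le> ?B x / e\<^sup>2" and lin_le: "\<bar>X x\<bar> * exp (e * \<bar>X x\<bar>) \<le> ?B x / e" for x
  proof -
    have "\<bar>X x\<bar> * exp (e * \<bar>X x\<bar>) \<le> exp (e * \<bar>X x\<bar>) / e * exp (e * \<bar>X x\<bar>)"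
      using le_exp by (intro mult_right_mono) auto
    also have "\<dots> = exp (2 * e * \<bar>X x\<bar>) / e" by (simp add: exp_add[symmetric])
    also have "\<dots> \<le> exp (3 * e * \<bar>X x\<bar>) / e" using e by (intro divide_right_mono) (auto intro: mult_right_mono)
    also have "\<dots> \<le> ?B x / e" using exp_abs_le[of "3 * e" "X x"] e by (intro divide_right_mono) auto
    finally show "\<bar>X x\<bar> * exp (e * \<bar>X x\<bar>) \<le> ?B x / e" .
    have "(X x)\<^sup>2 * exp (e * \<bar>X x\<bar>) = \<bar>X x\<bar> * \<bar>X x\<bar> * exp (e * \<bar>X x\<bar>)"
      by (simp add: power2_eq_square)
    also have "\<dots> \<le> (exp (e * \<bar>X x\<bar>) / e) * (exp (e * \<bar>X x\<bar>) / e) * exp (e * \<bar>X x\<bar>)"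
      using le_exp e by (intro mult_right_mono mult_mono) auto
    also have "\<dots> = exp (3 * e * \<bar>X x\<bar>) / e\<^sup>2" by (simp add: exp_add[symmetric] power2_eq_square)
    also have "\<dots> \<le> ?B x / e\<^sup>2" using exp_abs_le[of "3 * e" "X x"] by (intro divide_right_mono) auto
    finally show "(X x)\<^sup>2 * exp (e * \<bar>X x\<bar>) \<le> ?B x / e\<^sup>2" .
  qed
  have sq_le': "(X x)\<^sup>2 \<le> ?B x / e\<^sup>2" for x
  proof -
    have "(X x)\<^sup>2 * 1 \<le> (X x)\<^sup>2 * exp (e * \<bar>X x\<bar>)"
      using e by (intro mult_left_mono) auto
    also note sq_le
    finally show ?thesis by simp
  qed
  show sq: "integrable M (\<lambda>x. (X x)\<^sup>2)"
  proof (rule Bochner_Integration.integrable_bound[where f = "\<lambda>x. ?B x / e\<^sup>2"])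
    show "AE x in M. norm ((X x)\<^sup>2) \<le> norm (?B x / e\<^sup>2)"
    proof (rule AE_I2)
      fix x
      show "norm ((X x)\<^sup>2) \<le> norm (?B x / e\<^sup>2)"
        using sq_le'[of x] abs_ge_self[of "?B x / e\<^sup>2"] unfolding real_norm_def by simp
    qed
  qed (use B in auto)
  have intX: "integrable M X" by (rule square_integrable_imp_integrable[OF X sq])

  have remainder: "exp (s k * \<bar>x\<bar>) \<le> exp (e * \<bar>x\<bar>)" for k x
    using s by (auto intro: mult_right_mono)
  have int_s: "integrable M (\<lambda>x. exp (s k * X x))" and mgf_s: "expectation (\<lambda>x. exp (s k * X x)) = exp (K (s k))" for k
    using s[of k] \<delta> by (auto intro!: int mgf simp: e_def)
  have expK: "((\<lambda>h. exp (K h)) has_real_derivative K' h * exp (K h)) (at h)" if "\<bar>h\<bar> < \<delta>" for h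
    using K[OF that] by (auto intro!: derivative_eq_intros)

  have lim1: "(\<lambda>k. expectation (\<lambda>x. (exp (s k * X x) - 1) / s k)) \<longlonglongrightarrow> expectation X"
  proof (rule integral_dominated_convergence[where w = "\<lambda>x. ?B x / e"])
    show "AE x in M. (\<lambda>k. (exp (s k * X x) - 1) / s k) \<longlonglongrightarrow> X x"
    proof (rule AE_I2)
      fix x
      have "((\<lambda>h. exp (h * X x)) has_real_derivative X x) (at 0)" by (auto intro!: derivative_eq_intros)
      then have "((\<lambda>h. (exp (h * X x) - 1) / h) \<longlongrightarrow> X x) (at 0)" by (simp add: DERIV_def)
      from filterlim_compose[OF this s_at] show "(\<lambda>k. (exp (s k * X x) - 1) / s k) \<longlonglongrightarrow> X x" .
    qed
    fix k
    show "AE x in M. norm ((exp (s k * X x) - 1) / s k) \<le> ?B x / e"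
    proof (rule AE_I2)
      fix x
      have "\<bar>exp (s k * X x) - 1\<bar> / s k \<le> \<bar>s k * X x\<bar> * exp \<bar>s k * X x\<bar> / s k"
        using abs_exp_minus_one_le s(1)[of k] by (intro divide_right_mono) auto
      also have "\<dots> = \<bar>X x\<bar> * exp (s k * \<bar>X x\<bar>)"
        using s(1)[of k] by (simp add: abs_mult)
      also have "\<dots> \<le> \<bar>X x\<bar> * exp (e * \<bar>X x\<bar>)" using remainder by (intro mult_left_mono) auto
      also note lin_le
      finally show "norm ((exp (s k * X x) - 1) / s k) \<le> ?B x / e" using s(1)[of k] by simp
    qed
  qed (use B in auto)
  have val1: "expectation (\<lambda>x. (exp (s k * X x) - 1) / s k) = (exp (K (s k)) - 1) / s k" for k
    using int_s mgf_s by (simp add: prob_space)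
  have "(\<lambda>k. (exp (K (s k)) - 1) / s k) \<longlonglongrightarrow> K' 0"
  proof -
    have "((\<lambda>h. (exp (K h) - 1) / h) \<longlongrightarrow> K' 0) (at 0)"
      using expK[of 0] \<delta> by (simp add: DERIV_def K0)
    from filterlim_compose[OF this s_at] show ?thesis .
  qed
  then show mean: "expectation X = K' 0"
    by (rule LIMSEQ_unique[OF lim1[unfolded val1]])

  have lim2: "(\<lambda>k. expectation (\<lambda>x. (exp (s k * X x) - 1 - s k * X x) / (s k)\<^sup>2)) \<longlonglongrightarrow> expectation (\<lambda>x. (X x)\<^sup>2 / 2)"
  proof (rule integral_dominated_convergence[where w = "\<lambda>x. ?B x / e\<^sup>2"])
    show "AE x in M. (\<lambda>k. (exp (s k * X x) - 1 - s k * X x) / (s k)\<^sup>2) \<longlonglongrightarrow> (X x)\<^sup>2 / 2"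
    proof (rule AE_I2)
      fix x
      have "((\<lambda>h. (exp (h * X x) - h * X x - (exp (0 * X x) - 0 * X x)) / h\<^sup>2) \<longlongrightarrow> (X x)\<^sup>2 / 2) (at 0)"
        by (rule second_order_limit[where \<delta> = 1 and f' = "\<lambda>h. X x * exp (h * X x) - X x"])
           (auto intro!: derivative_eq_intros simp: power2_eq_square)
      from filterlim_compose[OF this s_at]
      show "(\<lambda>k. (exp (s k * X x) - 1 - s k * X x) / (s k)\<^sup>2) \<longlonglongrightarrow> (X x)\<^sup>2 / 2"
        by (simp add: algebra_simps)
    qed
    fix k
    show "AE x in M. norm ((exp (s k * X x) - 1 - s k * X x) / (s k)\<^sup>2) \<le> ?B x / e\<^sup>2"
    proof (rule AE_I2)
      fix x
      have "\<bar>exp (s k * X x) - 1 - s k * X x\<bar> / (s k)\<^sup>2 \<le> (s k * X x)\<^sup>2 * exp \<bar>s k * X x\<bar> / (s k)\<^sup>2"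
        using abs_exp_minus_linear_le by (intro divide_right_mono) auto
      also have "\<dots> = (X x)\<^sup>2 * exp (s k * \<bar>X x\<bar>)"
        using s(1)[of k] by (simp add: abs_mult power_mult_distrib)
      also have "\<dots> \<le> (X x)\<^sup>2 * exp (e * \<bar>X x\<bar>)" using remainder by (intro mult_left_mono) auto
      also note sq_le
      finally show "norm ((exp (s k * X x) - 1 - s k * X x) / (s k)\<^sup>2) \<le> ?B x / e\<^sup>2" by simp
    qed
  qed (use B in auto)
  have val2: "expectation (\<lambda>x. (exp (s k * X x) - 1 - s k * X x) / (s k)\<^sup>2)
      = (exp (K (s k)) - 1 - s k * K' 0) / (s k)\<^sup>2" for k
    using int_s mgf_s intX mean by (simp add: prob_space)
  have "(\<lambda>k. (exp (K (s k)) - 1 - s k * K' 0) / (s k)\<^sup>2) \<longlonglongrightarrow> (v + (K' 0)\<^sup>2) / 2"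
  proof -
    have "((\<lambda>h. (exp (K h) - h * K' 0 - (exp (K 0) - 0 * K' 0)) / h\<^sup>2) \<longlongrightarrow> (v + (K' 0)\<^sup>2) / 2) (at 0)"
    proof (rule second_order_limit[OF \<delta>, where f' = "\<lambda>h. K' h * exp (K h) - K' 0"])
      show "((\<lambda>h. K' h * exp (K h) - K' 0) has_real_derivative v + (K' 0)\<^sup>2) (at 0)"
        using K' K[of 0] expK[of 0] \<delta> by (auto intro!: derivative_eq_intros simp: K0 power2_eq_square)
    qed (auto intro!: derivative_eq_intros K simp: K0)
    from filterlim_compose[OF this s_at] show ?thesis by (simp add: K0 algebra_simps)
  qed
  then have "expectation (\<lambda>x. (X x)\<^sup>2 / 2) = (v + (K' 0)\<^sup>2) / 2"
    by (rule LIMSEQ_unique[OF lim2[unfolded val2]])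
  then have "expectation (\<lambda>x. (X x)\<^sup>2) = v + (K' 0)\<^sup>2" by simp
  then show "variance X = v"
    using variance_eq[OF intX sq] mean by simp
qed

section \<open>The standard normal distribution function\<close>

abbreviation Phi where "Phi \<equiv> cdf std_normal_distribution"

interpretation std_normal: real_distribution std_normal_distribution
  by (rule real_dist_normal_dist)

lemma emeasure_std_normal_singleton: "emeasure std_normal_distribution {x} = 0"
proof -
  have "AE y in lborel. y \<noteq> x" by (rule AE_lborel_singleton)
  then have "AE y in std_normal_distribution. y \<noteq> x" by (auto simp: AE_density)
  then show ?thesis
    by (subst (asm) AE_iff_measurable[OF _ refl]) auto
qed

lemma isCont_Phi: "isCont Phi x"
  unfolding std_normal.isCont_cdf by (simp add: measure_def emeasure_std_normal_singleton)

lemma Phi_less_Phi: "x < y \<Longrightarrow> Phi x < Phi y"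
proof -
  assume xy: "x < y"
  have "emeasure std_normal_distribution {x<..y} \<noteq> 0"
  proof
    assume "emeasure std_normal_distribution {x<..y} = 0"
    then have "{x<..y} \<in> null_sets std_normal_distribution" by (auto intro!: null_setsI)
    then have "AE t in lborel. t \<in> {x<..y} \<longrightarrow> ennreal (std_normal_density t) \<le> 0"
      by (subst (asm) null_sets_density_iff) (auto simp: normal_density_def)
    then have "AE t in lborel. t \<notin> {x<..y}"
    proof (rule AE_mp)
      show "AE t in lborel. (t \<in> {x<..y} \<longrightarrow> ennreal (std_normal_density t) \<le> 0) \<longrightarrow> t \<notin> {x<..y}"
      proof (rule AE_I2)
        fix t
        have "\<not> std_normal_density t \<le> 0" using normal_density_pos[of 1 0 t] by linarith
        then show "(t \<in> {x<..y} \<longrightarrow> ennreal (std_normal_density t) \<le> 0) \<longrightarrow> t \<notin> {x<..y}"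
          by (auto simp: ennreal_eq_0_iff)
      qed
    qed
    then have "emeasure lborel {t \<in> space lborel. \<not> t \<notin> {x<..y}} = 0"
      by (subst (asm) AE_iff_measurable[OF _ refl]) simp_all
    also have "{t \<in> space lborel. \<not> t \<notin> {x<..y}} = {x<..y}" by auto
    finally have "emeasure lborel {x<..y} = 0" .
    then show False using xy by simp
  qed
  then have "0 < measure std_normal_distribution {x<..y}"
    by (simp add: std_normal.emeasure_eq_measure zero_less_measure_iff)
  then show ?thesis using std_normal.cdf_diff_eq[OF xy] by simp
qed

lemma Phi_less_iff: "Phi x < Phi y \<longleftrightarrow> x < y"
  using Phi_less_Phi[of x y] Phi_less_Phi[of y x] by (cases x y rule: linorder_cases) auto

lemma Phi_surj: assumes "0 < p" "p < 1" obtains x where "Phi x = p"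
proof -
  have "\<forall>\<^sub>F x in at_bot. Phi x < p" "\<forall>\<^sub>F x in at_top. p < Phi x"
    using std_normal.cdf_lim_at_bot std_normal.cdf_lim_at_top_prob assms by (auto dest: order_tendstoD)
  then obtain a b where "Phi a < p" "p < Phi b"
    by (meson eventually_happens' trivial_limit_at_bot_linorder trivial_limit_at_top_linorder)
  moreover from this have "a < b" using Phi_less_iff[of a b] by linarith
  ultimately show ?thesis
    using IVT[of Phi a p b] isCont_Phi that by (auto simp: less_imp_le)
qed

lemma Phi_std_normal_quantile:
  assumes "0 < p" "p < 1"
  shows "Phi (std_normal_quantile p) = p"
proof -
  obtain x where "Phi x = p" by (rule Phi_surj[OF assms])
  then show ?thesis unfolding std_normal_quantile_def by (metis f_inv_into_f rangeI)
qed

lemma Phi_uminus: "Phi (- x) = 1 - Phi x"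
proof -
  have "distr std_normal_distribution borel uminus = std_normal_distribution"
  proof -
    have "distr (density lborel (\<lambda>x. ennreal (std_normal_density x))) borel uminus
       = distr (density lborel (\<lambda>x. ennreal (std_normal_density (- x)))) borel uminus"
      by (simp add: std_normal_density_def)
    also have "\<dots> = density (distr lborel borel uminus) (\<lambda>x. ennreal (std_normal_density x))"
      by (subst density_distr) auto
    finally show ?thesis by (simp add: lborel_distr_uminus)
  qed
  then have "Phi (- x) = measure (distr std_normal_distribution borel uminus) {..-x}"
    by (simp add: cdf_def)
  also have "\<dots> = measure std_normal_distribution {x..}"
    by (subst measure_distr) (auto simp: vimage_def atLeast_def)
  also have "{x..} = UNIV - {..x} \<union> {x}" by auto
  also have "measure std_normal_distribution (UNIV - {..x} \<union> {x}) = measure std_normal_distribution (UNIV - {..x})"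
    using emeasure_std_normal_singleton[of x] by (subst measure_Un_null_set) auto
  also have "\<dots> = 1 - Phi x"
    using std_normal.prob_compl[of "{..x}"] by (simp add: cdf_def)
  finally show ?thesis .
qed

text \<open>Completing the square: tilting the standard normal law by $k$ shifts its mean to $k$.\<close>

lemma std_normal_exponential_tilt:
  "(\<integral>w. indicator {..t} w * exp (k * w - k\<^sup>2 / 2) \<partial>std_normal_distribution) = Phi (t - k)"
proof -
  have "(\<integral>w. indicator {..t} w * exp (k * w - k\<^sup>2 / 2) \<partial>std_normal_distribution)
      = (\<integral>w. std_normal_density (w - k) * indicator {..t} w \<partial>lborel)"
    by (subst integral_density)
       (auto simp: std_normal_density_def exp_add[symmetric] power2_eq_square field_simps
             intro!: Bochner_Integration.integral_cong)
  also have "\<dots> = (\<integral>w. std_normal_density w * indicator {..t - k} w \<partial>lborel)"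
    by (subst lborel_integral_real_affine[where c = 1 and t = k])
       (auto split: split_indicator intro!: Bochner_Integration.integral_cong)
  also have "\<dots> = (\<integral>w. indicator {..t - k} w \<partial>std_normal_distribution)"
    by (subst integral_density) auto
  finally show ?thesis by (simp add: cdf_def)
qed

section \<open>Sample means\<close>

lemma sample_mean_measurable:
  assumes "\<And>i. i \<in> {1..n} \<Longrightarrow> sets (M i) = sets borel"
  shows "sample_mean n \<in> borel_measurable (PiM {1..n} M)"
proof -
  have "(\<lambda>x. x i) \<in> borel_measurable (PiM {1..n} M)" if "i \<in> {1..n}" for i
    using measurable_component_singleton[OF that, of M] assms[OF that] by (simp cong: measurable_cong_sets)
  then show ?thesis unfolding sample_mean_def[abs_def] by (intro borel_measurable_divide borel_measurable_sum) auto
qed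

text \<open>The law of a sample mean depends on the sample only through the law of one observation. The
bootstrap sample lives on a product space and the data on arbitrary spaces; this lemma puts both on
the same footing.\<close>

lemma distr_sample_mean:
  assumes X: "random_sample P n X D" and D: "real_distribution D"
  shows "distr P borel (\<lambda>\<omega>. sample_mean n (\<lambda>i. X i \<omega>)) =
         distr (PiM {1..n} (\<lambda>_. D)) borel (sample_mean n)"
proof -
  interpret P: prob_space P using X by (simp add: random_sample_def)
  interpret D: real_distribution D by fact
  interpret DD: product_prob_space "\<lambda>_. D" "{1..n}" by (rule product_prob_spaceI) (rule D.prob_space_axioms)
  show ?thesis
  proof (cases "n = 0")
    case True
    then show ?thesis
      using P.distr_const[of "0::real" borel] DD.P.distr_const[of "0::real" borel] by (simp add: sample_mean_def[abs_def])
  next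
    case False
    have rv: "X i \<in> borel_measurable P" if "i \<in> {1..n}" for i
      using X that by (auto simp: random_sample_def P.indep_vars_def)
    then have rv': "(\<lambda>x. \<lambda>i\<in>{1..n}. X i x) \<in> measurable P (PiM {1..n} (\<lambda>_. borel))"
      by (intro measurable_restrict) auto
    have "distr P (PiM {1..n} (\<lambda>_. borel)) (\<lambda>x. \<lambda>i\<in>{1..n}. X i x)
        = PiM {1..n} (\<lambda>i. distr P borel (X i))"
      using X False rv by (subst P.indep_vars_iff_distr_eq_PiM'[symmetric]) (auto simp: random_sample_def)
    also have "\<dots> = PiM {1..n} (\<lambda>_. D)"
      using X by (intro PiM_cong) (auto simp: random_sample_def)
    finally have *: "distr P (PiM {1..n} (\<lambda>_. borel)) (\<lambda>x. \<lambda>i\<in>{1..n}. X i x) = PiM {1..n} (\<lambda>_. D)" .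
    have "distr (PiM {1..n} (\<lambda>_. D)) borel (sample_mean n) =
        distr P borel (sample_mean n \<circ> (\<lambda>x. \<lambda>i\<in>{1..n}. X i x))"
      unfolding *[symmetric] by (rule distr_distr[OF sample_mean_measurable rv']) auto
    also have "sample_mean n \<circ> (\<lambda>x. \<lambda>i\<in>{1..n}. X i x) = (\<lambda>\<omega>. sample_mean n (\<lambda>i. X i \<omega>))"
      by (auto simp: sample_mean_def fun_eq_iff)
    finally show ?thesis by simp
  qed
qed

lemma coordinate_law:
  fixes D :: "real measure"
  assumes D: "real_distribution D"
  shows "(\<lambda>\<omega>. \<omega> j) \<in> borel_measurable (PiM UNIV (\<lambda>_::nat. D))"
    and "distr (PiM UNIV (\<lambda>_::nat. D)) borel (\<lambda>\<omega>. \<omega> j) = D"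
proof -
  interpret D: real_distribution D by fact
  show "(\<lambda>\<omega>. \<omega> j) \<in> borel_measurable (PiM UNIV (\<lambda>_::nat. D))"
    using measurable_component_singleton[of j UNIV "\<lambda>_. D"] by (simp cong: measurable_cong_sets)
  have "distr (PiM UNIV (\<lambda>_::nat. D)) borel (\<lambda>\<omega>. \<omega> j) = distr (PiM UNIV (\<lambda>_::nat. D)) D (\<lambda>\<omega>. \<omega> j)"
    by (rule distr_cong) auto
  then show "distr (PiM UNIV (\<lambda>_::nat. D)) borel (\<lambda>\<omega>. \<omega> j) = D"
    using distr_PiM_component[of UNIV "\<lambda>_. D" j] D.prob_space_axioms by simp
qed

text \<open>Relabelling by \<open>f\<close> reconciles two index conventions: samples are indexed from $1$, partial sums
in the central limit theorem from $0$.\<close>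

lemma indep_vars_coordinates:
  fixes D :: "real measure" and f :: "nat \<Rightarrow> nat"
  assumes D: "real_distribution D" and f: "inj f" and I: "I \<noteq> {}"
  shows "prob_space.indep_vars (PiM UNIV (\<lambda>_. D)) (\<lambda>_. borel) (\<lambda>i \<omega>. \<omega> (f i)) I"
proof -
  interpret D: real_distribution D by fact
  interpret DD: product_prob_space "\<lambda>_::nat. D" UNIV by (rule product_prob_spaceI) (rule D.prob_space_axioms)
  note rv = coordinate_law(1)[OF D] and law = coordinate_law(2)[OF D]
  have "distr (PiM UNIV (\<lambda>_::nat. D)) (PiM I (\<lambda>_. borel)) (\<lambda>\<omega>. \<lambda>i\<in>I. \<omega> (f i)) =
      distr (PiM UNIV (\<lambda>_::nat. D)) (PiM I (\<lambda>_. D)) (\<lambda>\<omega>. \<lambda>i\<in>I. \<omega> (f i))"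
    by (rule distr_cong) (auto intro!: sets_PiM_cong)
  also have "\<dots> = PiM I (\<lambda>_. D)"
    using f D.prob_space_axioms by (intro distr_PiM_reindex) (auto intro: inj_on_subset)
  finally show ?thesis
    by (subst DD.P.indep_vars_iff_distr_eq_PiM'[OF I rv]) (simp add: law)
qed

text \<open>The samples for different $n$ need not be related, whereas the central limit theorem speaks about
one infinite sequence. The sequence of coordinates of an infinite product supplies sample means with
the right laws, and weak convergence sees only the laws.\<close>

lemma sample_mean_CLT:
  assumes D: "real_distribution D" and \<sigma>: "\<sigma> > 0"
    and sq: "integrable D (\<lambda>x. x\<^sup>2)" and mean: "(\<integral>x. x \<partial>D) = m" and var: "(\<integral>x. (x - m)\<^sup>2 \<partial>D) = \<sigma>\<^sup>2"
  shows "weak_conv_m (\<lambda>n. distr (distr (PiM {1..n} (\<lambda>_. D)) borel (sample_mean n)) borel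
      (\<lambda>x. sqrt n * (x - m) / \<sigma>)) std_normal_distribution"
proof -
  interpret D: real_distribution D by fact
  let ?N = "PiM UNIV (\<lambda>_::nat. D)"
  interpret N: product_prob_space "\<lambda>_::nat. D" UNIV by (rule product_prob_spaceI) (rule D.prob_space_axioms)
  note rv[measurable] = coordinate_law(1)[OF D] and law = coordinate_law(2)[OF D]
  have int: "(\<integral>\<omega>. g (\<omega> j) \<partial>?N) = (\<integral>x. g x \<partial>D)" and integ: "integrable ?N (\<lambda>\<omega>. g (\<omega> j)) \<longleftrightarrow> integrable D g"
    if [measurable]: "g \<in> borel_measurable borel" for g :: "real \<Rightarrow> real" and j
    by (subst law[of j, symmetric], simp add: integral_distr integrable_distr_eq)+
  have rs: "random_sample ?N n (\<lambda>i \<omega>. \<omega> i) D" for n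
    unfolding random_sample_def using indep_vars_coordinates[OF D, of id "{1..n}"] law N.P.prob_space_axioms
    \<comment> \<open>for $n = 0$ the index set is empty and independence is vacuous\<close>
    by (cases "n = 0") (auto simp: N.P.indep_vars_def N.P.indep_sets_def)
  have "weak_conv_m (\<lambda>n. distr ?N borel (\<lambda>\<omega>. (\<Sum>i<n. \<omega> (Suc i) - m) / sqrt (n * \<sigma>\<^sup>2))) std_normal_distribution"
  proof (rule N.P.central_limit_theorem[OF _ _ \<sigma>, where \<mu> = D])
    show "N.P.indep_vars (\<lambda>i. borel) (\<lambda>i \<omega>. \<omega> (Suc i)) UNIV"
      by (rule indep_vars_coordinates[OF D]) auto
    show "N.P.expectation (\<lambda>\<omega>. \<omega> (Suc n)) = m" for n
      using int[of "\<lambda>x. x"] mean by simp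
    then show "N.P.variance (\<lambda>\<omega>. \<omega> (Suc n)) = \<sigma>\<^sup>2" for n
      using int[of "\<lambda>x. (x - m)\<^sup>2"] var by simp
    show "integrable ?N (\<lambda>\<omega>. (\<omega> (Suc n))\<^sup>2)" for n
      using integ[of "\<lambda>x. x\<^sup>2"] sq by simp
  qed (rule law)
  moreover have "distr ?N borel (\<lambda>\<omega>. (\<Sum>i<n. \<omega> (Suc i) - m) / sqrt (n * \<sigma>\<^sup>2)) =
      distr (distr (PiM {1..n} (\<lambda>_. D)) borel (sample_mean n)) borel (\<lambda>x. sqrt n * (x - m) / \<sigma>)" for n
  proof -
    have "(\<lambda>\<omega>. (\<Sum>i<n. \<omega> (Suc i) - m) / sqrt (n * \<sigma>\<^sup>2)) = (\<lambda>\<omega>. sqrt n * (sample_mean n \<omega> - m) / \<sigma>)"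
    proof
      fix \<omega> :: "nat \<Rightarrow> real"
      have "(\<Sum>i<n. \<omega> (Suc i)) = (\<Sum>i=1..n. \<omega> i)"
        by (simp add: sum.atLeast1_atMost_eq)
      moreover have "sqrt (real n) * sqrt (real n) = real n" by simp
      ultimately show "(\<Sum>i<n. \<omega> (Suc i) - m) / sqrt (n * \<sigma>\<^sup>2) = sqrt n * (sample_mean n \<omega> - m) / \<sigma>"
        using \<sigma> by (cases "n = 0") (auto simp: sample_mean_def sum_subtractf real_sqrt_mult field_simps)
    qed
    moreover have "sample_mean n \<in> borel_measurable ?N"
      unfolding sample_mean_def[abs_def] by measurable
    ultimately show ?thesis
      unfolding distr_sample_mean[OF rs D, symmetric] by (subst distr_distr) (simp_all add: comp_def)
  qed
  ultimately show ?thesis by simp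
qed

section \<open>Laws of the sample mean in a natural exponential family\<close>

context natural_exponential_family
begin

lemma sets_base_measure [measurable_cong]: "sets \<mu> = sets borel"
  using pdf_or_pmf by (auto simp: counting_borel_def)

lemma sets_nef_dist [simp, measurable_cong]: "sets (nef_dist \<mu> a b \<psi>) = sets borel"
  by (simp add: nef_dist_def sets_base_measure)

lemma nef_real_distribution: "\<psi> \<in> \<Psi> \<Longrightarrow> real_distribution (nef_dist \<mu> a b \<psi>)"
  using normalized by (simp add: real_distribution_def real_distribution_axioms_def)

text \<open>Relative to another member of the family, the base measure and the carrier cancel, and only a tilt
remains.\<close>

lemma nef_dist_tilt:
  "nef_dist \<mu> a b \<psi>' = density (nef_dist \<mu> a b \<psi>) (\<lambda>x. ennreal (exp ((\<psi>' - \<psi>) * x - (b \<psi>' - b \<psi>))))"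
proof -
  note a_measurable[measurable]
  have [measurable]: "nef_density a b \<psi> \<in> borel_measurable \<mu>"
    unfolding nef_density_def[abs_def] by measurable
  have "exp (\<psi>' * x - b \<psi>') = exp (\<psi> * x - b \<psi>) * exp ((\<psi>' - \<psi>) * x - (b \<psi>' - b \<psi>))" for x
    unfolding exp_add[symmetric] by (simp add: algebra_simps)
  then show ?thesis
    unfolding nef_dist_def
    by (subst density_density_eq)
       (auto simp: nef_density_def a_nonneg ennreal_mult'[symmetric] mult.assoc intro!: density_cong)
qed

definition mean_law :: "nat \<Rightarrow> real \<Rightarrow> real measure" where
  "mean_law n \<psi> = distr (PiM {1..n} (\<lambda>_. nef_dist \<mu> a b \<psi>)) borel (sample_mean n)"

lemma prob_space_sample: "\<psi> \<in> \<Psi> \<Longrightarrow> prob_space (PiM I (\<lambda>_. nef_dist \<mu> a b \<psi>))"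
  by (intro prob_space_PiM normalized)

lemma sample_mean_measurable_nef [measurable]:
  "sample_mean n \<in> borel_measurable (PiM {1..n} (\<lambda>_. nef_dist \<mu> a b \<psi>))"
  by (rule sample_mean_measurable) simp

lemma mean_law_real_distribution: "\<psi> \<in> \<Psi> \<Longrightarrow> real_distribution (mean_law n \<psi>)"
  unfolding mean_law_def
  by (rule prob_space.real_distribution_distr[OF prob_space_sample sample_mean_measurable_nef])

text \<open>The likelihood ratio of a whole sample depends on the sample only through its mean (sufficiency), so
the laws of the mean form an exponential family again, with $n$ in place of $1$.\<close>

lemma mean_law_tilt:
  assumes "\<psi> \<in> \<Psi>" "\<psi>' \<in> \<Psi>" "n \<ge> 1"
  shows "mean_law n \<psi>' = density (mean_law n \<psi>)
    (\<lambda>x. ennreal (exp (real n * (\<psi>' - \<psi>) * x - real n * (b \<psi>' - b \<psi>))))"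
proof -
  have "PiM {1..n} (\<lambda>_. nef_dist \<mu> a b \<psi>') = density (PiM {1..n} (\<lambda>_. nef_dist \<mu> a b \<psi>))
      (\<lambda>x. ennreal (\<Prod>i\<in>{1..n}. exp ((\<psi>' - \<psi>) * x i - (b \<psi>' - b \<psi>))))"
    unfolding nef_dist_tilt[of \<psi>' \<psi>]
    by (rule density_PiM_product[symmetric])
       (use normalized[of \<psi>] normalized[of \<psi>'] assms nef_dist_tilt[of \<psi>' \<psi>] in auto)
  also have "(\<lambda>x. ennreal (\<Prod>i\<in>{1..n}. exp ((\<psi>' - \<psi>) * x i - (b \<psi>' - b \<psi>)))) =
     (\<lambda>x. ennreal (exp (real n * (\<psi>' - \<psi>) * sample_mean n x - real n * (b \<psi>' - b \<psi>))))"
    using \<open>n \<ge> 1\<close>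
    by (auto simp: exp_sum[symmetric] sum_subtractf sum_distrib_left[symmetric] sample_mean_def fun_eq_iff)
  finally show ?thesis
    unfolding mean_law_def by (subst density_distr[OF _ sample_mean_measurable_nef]) simp_all
qed

text \<open>Stochastic monotonicity. It replaces every uniformity argument below: pointwise limits at fixed
local parameters control the bootstrap distribution at the random estimate.\<close>

lemma cdf_mean_law_antimono:
  assumes "\<psi> \<in> \<Psi>" "\<psi>' \<in> \<Psi>" "\<psi> \<le> \<psi>'" "n \<ge> 1"
  shows "cdf (mean_law n \<psi>') t \<le> cdf (mean_law n \<psi>) t"
  by (rule cdf_exponential_tilt_le[OF _ _ mean_law_tilt])
     (use assms mean_law_real_distribution in auto)

lemma has_derivative_b: "\<psi> \<in> \<Psi> \<Longrightarrow> (b has_real_derivative deriv b \<psi>) (at \<psi>)"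
  and has_derivative_deriv_b: "\<psi> \<in> \<Psi> \<Longrightarrow> (deriv b has_real_derivative deriv (deriv b) \<psi>) (at \<psi>)"
  using b_C2(1,2) param_space(1) at_within_open[of \<psi> \<Psi>]
  unfolding differentiable_on_def by (metis DERIV_deriv_iff_real_differentiable)+

lemma param_near:
  assumes "\<psi> \<in> \<Psi>"
  shows "\<exists>\<delta>>0. \<forall>h. \<bar>h\<bar> < \<delta> \<longrightarrow> \<psi> + h \<in> \<Psi>"
proof -
  obtain \<delta> where "\<delta> > 0" "ball \<psi> \<delta> \<subseteq> \<Psi>" using param_space(1) assms open_contains_ball by blast
  then show ?thesis by (auto simp: dist_real_def subset_eq intro!: exI[of _ \<delta>])
qed

lemma deriv_b_strict_mono: "strict_mono_on \<Psi> (deriv b)"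
proof (rule strict_mono_onI)
  fix x y assume xy: "x \<in> \<Psi>" "y \<in> \<Psi>" "x < y"
  then have "z \<in> \<Psi>" if "x \<le> z" "z \<le> y" for z
    using that param_space(2) unfolding is_interval_1 by blast
  then show "deriv b x < deriv b y"
    using xy(3) has_derivative_deriv_b b''_pos by (intro DERIV_pos_imp_increasing[OF xy(3)]) blast
qed

lemma natural_param_deriv_b: "\<psi> \<in> \<Psi> \<Longrightarrow> natural_param b \<Psi> (deriv b \<psi>) = \<psi>"
  unfolding natural_param_def
  by (rule the_inv_into_f_f[OF strict_mono_on_imp_inj_on[OF deriv_b_strict_mono]])

text \<open>By the tilt, the moment generating function at $h$ is $e^{b(\<psi> + h) - b(\<psi>)}$, because the
tilted measure has total mass $1$. Hence $b(\<psi> + \<cdot>) - b(\<psi>)$ is the cumulant generating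
function.\<close>

lemma nef_moments:
  assumes \<psi>: "\<psi> \<in> \<Psi>"
  shows "integrable (nef_dist \<mu> a b \<psi>) (\<lambda>x. x\<^sup>2)"
    "(\<integral>x. x \<partial>nef_dist \<mu> a b \<psi>) = deriv b \<psi>"
    "(\<integral>x. (x - deriv b \<psi>)\<^sup>2 \<partial>nef_dist \<mu> a b \<psi>) = deriv (deriv b) \<psi>"
proof -
  interpret D: real_distribution "nef_dist \<mu> a b \<psi>" using nef_real_distribution \<psi> .
  obtain \<delta> where \<delta>: "\<delta> > 0" "\<And>h. \<bar>h\<bar> < \<delta> \<Longrightarrow> \<psi> + h \<in> \<Psi>" using param_near[OF \<psi>] by blast
  have mgf: "integrable (nef_dist \<mu> a b \<psi>) (\<lambda>x. exp (h * x)) \<and>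
      D.expectation (\<lambda>x. exp (h * x)) = exp (b (\<psi> + h) - b \<psi>)" if h: "\<bar>h\<bar> < \<delta>" for h
  proof -
    interpret E: prob_space "nef_dist \<mu> a b (\<psi> + h)" using normalized \<delta>(2)[OF h] .
    have "(\<integral>\<^sup>+x. ennreal (exp (h * x - (b (\<psi> + h) - b \<psi>))) \<partial>nef_dist \<mu> a b \<psi>) = 1"
      using E.emeasure_space_1 nef_dist_tilt[of "\<psi> + h" \<psi>] by (simp add: emeasure_density)
    then have "has_bochner_integral (nef_dist \<mu> a b \<psi>) (\<lambda>x. exp (h * x - (b (\<psi> + h) - b \<psi>))) 1"
      by (intro has_bochner_integral_nn_integral) auto
    from has_bochner_integral_mult_right[OF this, of "exp (b (\<psi> + h) - b \<psi>)"]
    have "has_bochner_integral (nef_dist \<mu> a b \<psi>) (\<lambda>x. exp (h * x)) (exp (b (\<psi> + h) - b \<psi>))"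
      by (simp add: exp_add[symmetric])
    then show ?thesis by (auto simp: has_bochner_integral_iff)
  qed
  have d: "((\<lambda>h. b (\<psi> + h) - b \<psi>) has_real_derivative deriv b (\<psi> + h)) (at h)" if "\<bar>h\<bar> < \<delta>" for h
    using has_derivative_b[OF \<delta>(2)[OF that]] by (auto intro!: derivative_eq_intros DERIV_chain'[where f = "\<lambda>h. \<psi> + h"])
  have d2: "((\<lambda>h. deriv b (\<psi> + h)) has_real_derivative deriv (deriv b) \<psi>) (at 0)"
    using has_derivative_deriv_b[OF \<psi>] DERIV_shift[of "deriv b" "deriv (deriv b) \<psi>" 0 \<psi>]
    by (simp add: add.commute)
  note * = D.mean_variance_of_mgf[OF _ \<delta>(1) _ _ d d2, of "\<lambda>x. x"]
  show "integrable (nef_dist \<mu> a b \<psi>) (\<lambda>x. x\<^sup>2)"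
    "(\<integral>x. x \<partial>nef_dist \<mu> a b \<psi>) = deriv b \<psi>"
    "(\<integral>x. (x - deriv b \<psi>)\<^sup>2 \<partial>nef_dist \<mu> a b \<psi>) = deriv (deriv b) \<psi>"
    using * mgf by auto
qed

lemma mean_law_CLT:
  assumes \<psi>: "\<psi> \<in> \<Psi>" and \<sigma>: "\<sigma> > 0" "\<sigma>\<^sup>2 = deriv (deriv b) \<psi>"
  shows "weak_conv_m (\<lambda>n. distr (mean_law n \<psi>) borel (\<lambda>x. sqrt n * (x - deriv b \<psi>) / \<sigma>))
    std_normal_distribution"
  unfolding mean_law_def
  by (rule sample_mean_CLT[OF nef_real_distribution[OF \<psi>] \<sigma>(1)]) (simp_all add: nef_moments[OF \<psi>] \<sigma>(2))

lemma eventually_param: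
  assumes "\<psi> \<in> \<Psi>" "c \<longlonglongrightarrow> h"
  shows "\<forall>\<^sub>F n in sequentially. \<psi> + c n / sqrt n \<in> \<Psi>"
proof -
  have "(\<lambda>n. 1 / sqrt (real n)) \<longlonglongrightarrow> 0" by real_asymp
  from tendsto_add[OF tendsto_const tendsto_mult[OF assms(2) this]]
  have "(\<lambda>n. \<psi> + c n / sqrt n) \<longlonglongrightarrow> \<psi>" by simp
  then show ?thesis
    by (rule topological_tendstoD[OF _ param_space(1) assms(1)])
qed

end

section \<open>Local asymptotic normality\<close>

lemma filterlim_over_sqrt_at_0:
  fixes h :: real
  assumes "h \<noteq> 0"
  shows "filterlim (\<lambda>n. h / sqrt (real n)) (at 0) sequentially"
proof -
  have "(\<lambda>n. h / sqrt (real n)) \<longlonglongrightarrow> 0" by real_asymp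
  moreover have "\<forall>\<^sub>F n in sequentially. h / sqrt (real n) \<noteq> 0"
    using assms by (intro eventually_sequentiallyI[of 1]) auto
  ultimately show ?thesis by (simp add: filterlim_at)
qed

context natural_exponential_family
begin

lemma deriv_b_increment:
  assumes \<psi>: "\<psi> \<in> \<Psi>"
  shows "(\<lambda>n. sqrt n * (deriv b (\<psi> + h / sqrt n) - deriv b \<psi>)) \<longlonglongrightarrow> h * deriv (deriv b) \<psi>"
proof (cases "h = 0")
  case False
  have "((\<lambda>x. (deriv b (\<psi> + x) - deriv b \<psi>) / x) \<longlongrightarrow> deriv (deriv b) \<psi>) (at 0)"
    using has_derivative_deriv_b[OF \<psi>] by (simp add: DERIV_def)
  from filterlim_compose[OF this filterlim_over_sqrt_at_0[OF False]]
  have "(\<lambda>n. h * ((deriv b (\<psi> + h / sqrt n) - deriv b \<psi>) / (h / sqrt n))) \<longlonglongrightarrow> h * deriv (deriv b) \<psi>"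
    by (intro tendsto_mult tendsto_const)
  then show ?thesis using False by (simp add: mult.commute)
qed simp

text \<open>The limit is the logarithm of the normalizing constant of the limiting Gaussian tilt; the first-order term removed on
the left is absorbed by centring the sample mean.\<close>

lemma b_increment:
  assumes \<psi>: "\<psi> \<in> \<Psi>"
  shows "(\<lambda>n. real n * (b (\<psi> + h / sqrt n) - b \<psi>) - sqrt n * h * deriv b \<psi>)
    \<longlonglongrightarrow> h\<^sup>2 * deriv (deriv b) \<psi> / 2"
proof (cases "h = 0")
  case False
  obtain \<delta> where \<delta>: "\<delta> > 0" "\<And>h. \<bar>h\<bar> < \<delta> \<Longrightarrow> \<psi> + h \<in> \<Psi>" using param_near[OF \<psi>] by blast
  let ?f = "\<lambda>x. b (\<psi> + x) - x * deriv b \<psi>"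
  have "((\<lambda>x. (?f x - ?f 0) / x\<^sup>2) \<longlongrightarrow> deriv (deriv b) \<psi> / 2) (at 0)"
  proof (rule second_order_limit[OF \<delta>(1), where f' = "\<lambda>x. deriv b (\<psi> + x) - deriv b \<psi>"])
    show "((\<lambda>x. deriv b (\<psi> + x) - deriv b \<psi>) has_real_derivative deriv (deriv b) \<psi>) (at 0)"
      using has_derivative_deriv_b[OF \<psi>]
      by (auto intro!: derivative_eq_intros DERIV_chain'[where f = "\<lambda>h. \<psi> + h"])
    show "(?f has_real_derivative deriv b (\<psi> + x) - deriv b \<psi>) (at x)" if "\<bar>x\<bar> < \<delta>" for x
      using has_derivative_b[OF \<delta>(2)[OF that]]
      by (auto intro!: derivative_eq_intros DERIV_chain'[where f = "\<lambda>h. \<psi> + h"])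
  qed simp
  from filterlim_compose[OF this filterlim_over_sqrt_at_0[OF False]]
  have "(\<lambda>n. h\<^sup>2 * ((?f (h / sqrt n) - ?f 0) / (h / sqrt n)\<^sup>2)) \<longlonglongrightarrow> h\<^sup>2 * (deriv (deriv b) \<psi> / 2)"
    by (intro tendsto_mult tendsto_const)
  moreover have "h\<^sup>2 * ((?f (h / sqrt n) - ?f 0) / (h / sqrt n)\<^sup>2) =
      real n * (b (\<psi> + h / sqrt n) - b \<psi>) - sqrt n * h * deriv b \<psi>" for n
  proof -
    have "real n = sqrt n * sqrt n" by simp
    then have "real n * (h / sqrt n) = sqrt n * h"
      by (cases "n = 0") (simp_all add: field_simps)
    moreover have "h\<^sup>2 * (y / (h / sqrt n)\<^sup>2) = real n * y" for y
      using False by (simp add: power_divide)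
    moreover have "real n * (?f (h / sqrt n) - ?f 0) =
        real n * (b (\<psi> + h / sqrt n) - b \<psi>) - real n * (h / sqrt n) * deriv b \<psi>"
      by (simp add: algebra_simps)
    ultimately show ?thesis by simp
  qed
  ultimately show ?thesis by simp
qed simp

text \<open>A central limit theorem under the local alternatives $\<psi> + h/\<surd>n$, obtained from the one at
$\<psi>$ by change of measure (this is Le Cam's third lemma). Under $\<psi>$ let $W$ be the
standardized mean. The likelihood ratio is $e^{\<sigma> h W - c_n}$ with
$c_n \<longlonglongrightarrow> \<sigma>^2 h^2 / 2$, so the probability of $W \<le> t$ under the
alternative is $e^{-c_n}$ times the expectation of $1_{W \<le> t}\, e^{\<sigma> h W}$. For $h \<ge> 0$
this integrand is bounded by $e^{\<sigma> h t}$ and has a single discontinuity, so weak convergence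
applies directly, without uniform integrability. The limit is a tilted, hence shifted, normal law.\<close>

lemma cdf_mean_law_limit_fixed:
  assumes \<psi>: "\<psi> \<in> \<Psi>" and \<sigma>: "\<sigma> > 0" "\<sigma>\<^sup>2 = deriv (deriv b) \<psi>" and h: "h \<ge> 0"
  shows "(\<lambda>n. cdf (mean_law n (\<psi> + h / sqrt n)) (deriv b \<psi> + \<sigma> * t / sqrt n)) \<longlonglongrightarrow> Phi (t - \<sigma> * h)"
proof -
  let ?m = "deriv b \<psi>"
  define W where "W n = distr (mean_law n \<psi>) borel (\<lambda>x. sqrt n * (x - ?m) / \<sigma>)" for n :: nat
  define c where "c n = real n * (b (\<psi> + h / sqrt n) - b \<psi>) - sqrt n * h * ?m" for n :: nat
  let ?F = "\<lambda>w. indicator {..t} w * exp (\<sigma> * h * w) :: real"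
  have W_real: "real_distribution (W n)" for n
  proof -
    interpret real_distribution "mean_law n \<psi>" by (rule mean_law_real_distribution[OF \<psi>])
    show ?thesis unfolding W_def by (intro real_distribution_distr) simp
  qed
  have "(\<lambda>n. integral\<^sup>L (W n) ?F) \<longlonglongrightarrow> integral\<^sup>L std_normal_distribution ?F"
  proof (rule weak_conv_imp_bdd_ae_continuous_conv[where B = "exp (\<sigma> * h * t)"])
    show "weak_conv_m W std_normal_distribution"
      unfolding W_def by (rule mean_law_CLT[OF \<psi> \<sigma>])
    have "isCont ?F x" if "x \<noteq> t" for x
    proof (cases "x < t")
      case True
      then have "\<forall>\<^sub>F w in nhds x. ?F w = exp (\<sigma> * h * w)"
        by (intro eventually_mono[OF eventually_nhds_in_open[of "{..<t}" x]]) auto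
      then show ?thesis by (rule isCont_cong[THEN iffD2]) (intro continuous_intros)
    next
      case False
      with that have "t < x" by simp
      then have "\<forall>\<^sub>F w in nhds x. ?F w = 0"
        by (intro eventually_mono[OF eventually_nhds_in_open[of "{t<..}" x]]) auto
      then show ?thesis by (rule isCont_cong[THEN iffD2]) (intro continuous_intros)
    qed
    then have "{x. \<not> isCont ?F x} \<subseteq> {t}" by blast
    then show "emeasure std_normal_distribution {x. \<not> isCont ?F x} = 0"
      using emeasure_std_normal_singleton[of t] emeasure_mono[of "{x. \<not> isCont ?F x}" "{t}" std_normal_distribution]
      by auto
    show "norm (?F w) \<le> exp (\<sigma> * h * t)" for w
      using \<sigma>(1) h by (auto split: split_indicator intro!: mult_left_mono)
  qed (use W_real real_dist_normal_dist in auto)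
  moreover have "(\<lambda>n. exp (- c n)) \<longlonglongrightarrow> exp (- (h\<^sup>2 * \<sigma>\<^sup>2 / 2))"
    unfolding c_def \<sigma>(2) by (intro tendsto_exp tendsto_minus b_increment[OF \<psi>])
  ultimately have "(\<lambda>n. exp (- c n) * integral\<^sup>L (W n) ?F) \<longlonglongrightarrow>
      exp (- (h\<^sup>2 * \<sigma>\<^sup>2 / 2)) * integral\<^sup>L std_normal_distribution ?F"
    by (intro tendsto_mult)
  also have "exp (- (h\<^sup>2 * \<sigma>\<^sup>2 / 2)) * integral\<^sup>L std_normal_distribution ?F =
      (\<integral>w. indicator {..t} w * exp (\<sigma> * h * w - (\<sigma> * h)\<^sup>2 / 2) \<partial>std_normal_distribution)"
    unfolding integral_mult_right_zero[symmetric]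
  proof (rule Bochner_Integration.integral_cong[OF refl])
    fix w
    have "\<sigma> * h * w - (\<sigma> * h)\<^sup>2 / 2 = - (h\<^sup>2 * \<sigma>\<^sup>2 / 2) + \<sigma> * h * w"
      by (simp add: power_mult_distrib mult.commute)
    then show "exp (- (h\<^sup>2 * \<sigma>\<^sup>2 / 2)) * ?F w = indicator {..t} w * exp (\<sigma> * h * w - (\<sigma> * h)\<^sup>2 / 2)"
      by (simp only: exp_add mult.left_commute)
  qed
  also have "\<dots> = Phi (t - \<sigma> * h)" by (rule std_normal_exponential_tilt)
  finally have lim: "(\<lambda>n. exp (- c n) * integral\<^sup>L (W n) ?F) \<longlonglongrightarrow> Phi (t - \<sigma> * h)" .
  have "\<forall>\<^sub>F n in sequentially. \<psi> + h / sqrt n \<in> \<Psi>"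
    by (rule eventually_param[OF \<psi> tendsto_const])
  then have "\<forall>\<^sub>F n in sequentially. exp (- c n) * integral\<^sup>L (W n) ?F =
     cdf (mean_law n (\<psi> + h / sqrt n)) (?m + \<sigma> * t / sqrt n)"
    using eventually_ge_at_top[of 1]
  proof eventually_elim
    case (elim n)
    let ?\<psi> = "\<psi> + h / sqrt n" and ?x = "?m + \<sigma> * t / sqrt n"
    let ?g = "\<lambda>x. exp (real n * (?\<psi> - \<psi>) * x - real n * (b ?\<psi> - b \<psi>))"
    interpret L: real_distribution "mean_law n \<psi>" by (rule mean_law_real_distribution[OF \<psi>])
    have n: "sqrt n > 0" "real n / sqrt n = sqrt n" using elim by (auto simp: real_div_sqrt)
    have "cdf (mean_law n ?\<psi>) ?x = (\<integral>x. indicator {..?x} x \<partial>mean_law n ?\<psi>)"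
      using real_distribution.space_eq_univ[OF mean_law_real_distribution[OF elim(1)]]
      by (simp add: cdf_def)
    also have "\<dots> = (\<integral>x. ?g x * indicator {..?x} x \<partial>mean_law n \<psi>)"
      unfolding mean_law_tilt[OF \<psi> elim] by (subst integral_density) auto
    also have "\<dots> = (\<integral>x. exp (- c n) * ?F (sqrt n * (x - ?m) / \<sigma>) \<partial>mean_law n \<psi>)"
    proof (rule Bochner_Integration.integral_cong[OF refl])
      fix x
      define w where "w = sqrt n * (x - ?m) / \<sigma>"
      have iff: "x \<le> ?x \<longleftrightarrow> w \<le> t" using n(1) \<sigma>(1) by (simp add: w_def field_simps)
      have exponent: "real n * (?\<psi> - \<psi>) * x - real n * (b ?\<psi> - b \<psi>) = - c n + \<sigma> * h * w"
      proof -
        have "real n * (?\<psi> - \<psi>) = h * (real n / sqrt n)" by simp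
        also note n(2)
        finally have "real n * (?\<psi> - \<psi>) = h * sqrt n" .
        moreover have "\<sigma> * h * w = h * sqrt n * (x - ?m)" using \<sigma>(1) by (simp add: w_def)
        ultimately show ?thesis unfolding c_def by (simp add: algebra_simps)
      qed
      have "?g x * indicator {..?x} x = exp (- c n) * ?F w"
        unfolding exponent exp_add using iff by (simp add: indicator_def)
      then show "?g x * indicator {..?x} x = exp (- c n) * ?F (sqrt n * (x - ?m) / \<sigma>)"
        by (simp only: w_def)
    qed
    also have "\<dots> = exp (- c n) * integral\<^sup>L (W n) ?F"
      unfolding W_def by (subst integral_distr) auto
    finally show ?case by simp
  qed
  from Lim_transform_eventually[OF lim this] show ?thesis .
qed

text \<open>Convergent local parameters and thresholds in place of fixed ones: the distribution function is
monotone in both and its limit is continuous, so squeezing suffices.\<close>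

lemma cdf_mean_law_limit:
  assumes \<psi>: "\<psi> \<in> \<Psi>" and \<sigma>: "\<sigma> > 0" "\<sigma>\<^sup>2 = deriv (deriv b) \<psi>"
    and h_n: "\<forall>\<^sub>F n in sequentially. 0 \<le> h_n n" "h_n \<longlonglongrightarrow> h" and t_n: "t_n \<longlonglongrightarrow> t"
  shows "(\<lambda>n. cdf (mean_law n (\<psi> + h_n n / sqrt n)) (deriv b \<psi> + \<sigma> * t_n n / sqrt n))
    \<longlonglongrightarrow> Phi (t - \<sigma> * h)"
proof -
  let ?G = "\<lambda>h t n. cdf (mean_law n (\<psi> + h / sqrt n)) (deriv b \<psi> + \<sigma> * t / sqrt n)"
  have h0: "h \<ge> 0" using tendsto_lowerbound[OF h_n(2,1)] by simp
  have compare: "\<forall>\<^sub>F n in sequentially. ?G (h1 n) (t1 n) n \<le> ?G (h2 n) (t2 n) n"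
    if h: "\<forall>\<^sub>F n in sequentially. h2 n \<le> h1 n" "h1 \<longlonglongrightarrow> l1" "h2 \<longlonglongrightarrow> l2"
      and t: "\<forall>\<^sub>F n in sequentially. t1 n \<le> t2 n" for h1 h2 t1 t2 l1 l2
    using eventually_param[OF \<psi> h(2)] eventually_param[OF \<psi> h(3)] h(1) t eventually_ge_at_top[of 1]
  proof eventually_elim
    case (elim n)
    interpret L: real_distribution "mean_law n (\<psi> + h2 n / sqrt n)"
      by (rule mean_law_real_distribution[OF elim(2)])
    have "?G (h1 n) (t1 n) n \<le> ?G (h2 n) (t1 n) n"
      using elim by (intro cdf_mean_law_antimono add_left_mono divide_right_mono) auto
    also have "\<dots> \<le> ?G (h2 n) (t2 n) n"
      using elim \<sigma>(1) by (intro L.cdf_nondecreasing add_left_mono divide_right_mono mult_left_mono) auto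
    finally show ?case .
  qed
  have Phi_at_0: "((\<lambda>e. Phi (g e)) \<longlongrightarrow> Phi (g 0)) (at_right 0)" if "isCont g 0" for g :: "real \<Rightarrow> real"
    using isCont_o2[OF that isCont_Phi] by (auto simp: isCont_def intro: filterlim_mono[OF _ order_refl at_le])
  show ?thesis
  proof (rule order_tendstoI)
    fix y assume y: "y < Phi (t - \<sigma> * h)"
    have "((\<lambda>e. Phi (t - e - \<sigma> * (h + e))) \<longlongrightarrow> Phi (t - \<sigma> * h)) (at_right 0)"
      using Phi_at_0[of "\<lambda>e. t - e - \<sigma> * (h + e)"] by simp
    from eventually_conj[OF order_tendstoD(1)[OF this y] eventually_at_right_less]
    have "\<forall>\<^sub>F e in at_right 0. y < Phi (t - e - \<sigma> * (h + e)) \<and> 0 < e" .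
    then obtain e where e: "y < Phi (t - e - \<sigma> * (h + e))" "0 < e"
      using eventually_happens'[OF trivial_limit_at_right_real] by blast
    have "(\<lambda>n. ?G (h + e) (t - e) n) \<longlonglongrightarrow> Phi (t - e - \<sigma> * (h + e))"
      using h0 e(2) by (intro cdf_mean_law_limit_fixed[OF \<psi> \<sigma>]) auto
    from order_tendstoD(1)[OF this e(1)] show "\<forall>\<^sub>F n in sequentially. y < ?G (h_n n) (t_n n) n"
    proof (rule eventually_elim2)
      show "\<forall>\<^sub>F n in sequentially. ?G (h + e) (t - e) n \<le> ?G (h_n n) (t_n n) n"
        using order_tendstoD(2)[OF h_n(2), of "h + e"] order_tendstoD(1)[OF t_n, of "t - e"] e(2)
        by (intro compare[OF _ tendsto_const h_n(2)]) (auto elim: eventually_mono)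
    qed auto
  next
    fix y assume y: "Phi (t - \<sigma> * h) < y"
    \<comment> \<open>the comparison parameter is cut off at 0 because the limit is known for nonnegative ones only\<close>
    have "isCont (\<lambda>e. t + e - \<sigma> * max 0 (h - e)) 0" by (intro continuous_intros)
    from Phi_at_0[OF this] have "((\<lambda>e. Phi (t + e - \<sigma> * max 0 (h - e))) \<longlongrightarrow> Phi (t - \<sigma> * h)) (at_right 0)"
      using h0 by (simp add: max_absorb2)
    from eventually_conj[OF order_tendstoD(2)[OF this y] eventually_at_right_less]
    have "\<forall>\<^sub>F e in at_right 0. Phi (t + e - \<sigma> * max 0 (h - e)) < y \<and> 0 < e" .
    then obtain e where e: "Phi (t + e - \<sigma> * max 0 (h - e)) < y" "0 < e"
      using eventually_happens'[OF trivial_limit_at_right_real] by blast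
    have "(\<lambda>n. ?G (max 0 (h - e)) (t + e) n) \<longlonglongrightarrow> Phi (t + e - \<sigma> * max 0 (h - e))"
      by (intro cdf_mean_law_limit_fixed[OF \<psi> \<sigma>]) auto
    from order_tendstoD(2)[OF this e(1)] show "\<forall>\<^sub>F n in sequentially. ?G (h_n n) (t_n n) n < y"
    proof (rule eventually_elim2)
      show "\<forall>\<^sub>F n in sequentially. ?G (h_n n) (t_n n) n \<le> ?G (max 0 (h - e)) (t + e) n"
        using order_tendstoD(1)[OF h_n(2), of "h - e"] order_tendstoD(2)[OF t_n, of "t + e"] e(2) h_n(1)
        by (intro compare[OF _ h_n(2) tendsto_const]) (auto elim: eventually_mono eventually_elim2)
    qed auto
  qed
qed

end

section \<open>Bootstrap quantiles\<close>

text \<open>Truncating the estimator at \<open>d\<close> sets its distribution function to $0$ below \<open>d\<close>, which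
keeps it right continuous and monotone, so its quantile is a generalized inverse.\<close>

lemma truncated_cdf_pseudoinverse:
  assumes M: "real_distribution M" and \<alpha>: "0 < \<alpha>" "\<alpha> < 1"
  shows "Inf {x. \<alpha> \<le> (if d \<le> x then cdf M x else 0)} \<le> t \<longleftrightarrow> d \<le> t \<and> \<alpha> \<le> cdf M t"
proof -
  interpret M: real_distribution M by fact
  let ?G = "\<lambda>x. if d \<le> x then cdf M x else 0"
  interpret right_continuous_mono ?G 0 1
  proof
    show "mono ?G" by (auto intro!: monoI M.cdf_nondecreasing M.cdf_nonneg)
    show "(?G \<longlongrightarrow> 0) at_bot"
      by (rule tendsto_eventually, rule eventually_mono[OF eventually_gt_at_bot[of d]]) auto
    show "(?G \<longlongrightarrow> 1) at_top"
      by (rule Lim_transform_eventually[OF M.cdf_lim_at_top_prob])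
         (rule eventually_mono[OF eventually_ge_at_top[of d]], auto)
    fix x
    show "continuous (at_right x) ?G"
    proof (cases "d \<le> x")
      case True
      have "\<forall>\<^sub>F y in at_right x. cdf M y = ?G y"
        using True by (auto simp: eventually_at_filter)
      then show ?thesis
        using M.cdf_is_right_cont[of x] True
        by (auto simp: continuous_within intro: Lim_transform_eventually)
    next
      case False
      then have "\<forall>\<^sub>F y in at_right x. y < d"
        by (intro order_tendstoD(2)[OF tendsto_ident_at]) auto
      then have "\<forall>\<^sub>F y in at_right x. ?G y = 0" by eventually_elim auto
      then show ?thesis
        using False by (auto simp: continuous_within intro: tendsto_eventually)
    qed
  qed
  show ?thesis using pseudoinverse[OF \<alpha>, of t] \<alpha> by (auto split: if_splits)
qed

context natural_exponential_family
begin

lemma bootstrap_cdf_eq: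
  assumes "\<psi> \<in> \<Psi>"
  shows "bootstrap_cdf \<mu> a b \<Psi> d n (deriv b \<psi>) x = (if d \<le> x then cdf (mean_law n \<psi>) x else 0)"
proof -
  let ?P = "PiM {1..n} (\<lambda>_. nef_dist \<mu> a b \<psi>)"
  have "cdf (mean_law n \<psi>) x = measure ?P (sample_mean n -` {..x} \<inter> space ?P)"
    unfolding mean_law_def cdf_def by (rule measure_distr[OF sample_mean_measurable_nef]) simp
  then show ?thesis
    unfolding bootstrap_cdf_def nef_mean_dist_def natural_param_deriv_b[OF assms] restricted_mle_def
    by (auto simp: Let_def vimage_def Int_def conj_commute)
qed

lemma bootstrap_quantile_le_iff:
  assumes "\<psi> \<in> \<Psi>" "0 < \<alpha>" "\<alpha> < 1"
  shows "bootstrap_quantile u \<mu> a b \<Psi> d n \<alpha> (deriv b \<psi>) \<le> t \<longleftrightarrow> d \<le> t \<and> \<alpha> \<le> cdf (mean_law n \<psi>) t"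
proof -
  have "deriv b \<psi> \<in> mean_space b \<Psi>" using assms by (simp add: mean_space_def)
  then show ?thesis
    unfolding bootstrap_quantile_def
    using truncated_cdf_pseudoinverse[OF mean_law_real_distribution[OF assms(1)] assms(2,3)]
    by (simp add: bootstrap_cdf_eq[OF assms(1)])
qed

lemma deriv_b_le_iff: "\<psi> \<in> \<Psi> \<Longrightarrow> \<psi>' \<in> \<Psi> \<Longrightarrow> deriv b \<psi> \<le> deriv b \<psi>' \<longleftrightarrow> \<psi> \<le> \<psi>'"
  using strict_mono_on_less_eq[OF deriv_b_strict_mono] by blast

lemma continuous_deriv_b: "continuous_on \<Psi> (deriv b)"
  by (intro continuous_at_imp_continuous_on ballI DERIV_isCont[OF has_derivative_deriv_b])

lemma mean_space_interval: "is_interval (mean_space b \<Psi>)"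
  unfolding mean_space_def is_interval_connected_1
  using param_space(2) continuous_deriv_b
  by (intro connected_continuous_image) (auto simp: is_interval_connected_1)

lemma open_mean_space: "open (mean_space b \<Psi>)"
  using injective_eq_1d_open_map_UNIV[OF continuous_deriv_b param_space(2)]
    strict_mono_on_imp_inj_on[OF deriv_b_strict_mono] param_space(1)
  by (auto simp: mean_space_def)

text \<open>Stochastic monotonicity again; it also settles the measurability of the random interval.\<close>

lemma bootstrap_quantile_mono_on:
  assumes "0 < \<alpha>" "\<alpha> < 1" "n \<ge> 1"
  shows "mono_on (mean_space b \<Psi>) (bootstrap_quantile u \<mu> a b \<Psi> d n \<alpha>)"
proof (rule mono_onI)
  fix \<theta> \<theta>' assume "\<theta> \<in> mean_space b \<Psi>" "\<theta>' \<in> mean_space b \<Psi>" "\<theta> \<le> \<theta>'"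
  then obtain \<psi> \<psi>' where \<psi>: "\<psi> \<in> \<Psi>" "\<psi>' \<in> \<Psi>" "\<theta> = deriv b \<psi>" "\<theta>' = deriv b \<psi>'" "\<psi> \<le> \<psi>'"
    by (auto simp: mean_space_def deriv_b_le_iff)
  let ?t = "bootstrap_quantile u \<mu> a b \<Psi> d n \<alpha> \<theta>'"
  have "d \<le> ?t \<and> \<alpha> \<le> cdf (mean_law n \<psi>') ?t"
    using bootstrap_quantile_le_iff[OF \<psi>(2) assms(1,2)] \<psi>(4) by blast
  then show "bootstrap_quantile u \<mu> a b \<Psi> d n \<alpha> \<theta> \<le> ?t"
    using bootstrap_quantile_le_iff[OF \<psi>(1) assms(1,2)] \<psi>(3)
      cdf_mean_law_antimono[OF \<psi>(1,2,5) assms(3)] order.trans by blast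
qed

lemma bootstrap_quantile_measurable:
  assumes "0 < \<alpha>" "\<alpha> < 1" "n \<ge> 1" and u: "u n \<alpha> \<in> borel_measurable borel"
  shows "bootstrap_quantile u \<mu> a b \<Psi> d n \<alpha> \<in> borel_measurable borel"
proof -
  have "(\<lambda>\<theta>. if \<theta> \<in> mean_space b \<Psi> then bootstrap_quantile u \<mu> a b \<Psi> d n \<alpha> \<theta> else u n \<alpha> \<theta>)
      \<in> borel_measurable borel"
    using borel_measurable_mono_on_fnc[OF bootstrap_quantile_mono_on[OF assms(1-3)]] borel_open[OF open_mean_space]
    by (subst measurable_If_restrict_space_iff) (auto intro: measurable_restrict_space1 u)
  moreover have "(\<lambda>\<theta>. if \<theta> \<in> mean_space b \<Psi> then bootstrap_quantile u \<mu> a b \<Psi> d n \<alpha> \<theta> else u n \<alpha> \<theta>)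
      = bootstrap_quantile u \<mu> a b \<Psi> d n \<alpha>"
    by (auto simp: fun_eq_iff bootstrap_quantile_def)
  ultimately show ?thesis by simp
qed

text \<open>The distribution functions at all estimates between \<open>d\<close> and $b'(\<psi> + h/\<surd>n)$ lie above the
one at the right end point, whose limit exceeds \<open>\<alpha>\<close>. One pointwise limit thus bounds the
quantile for all these estimates at once. The next lemma is the mirror image.\<close>

lemma eventually_quantile_le:
  assumes \<psi>: "\<psi> \<in> \<Psi>" and \<sigma>: "\<sigma> > 0" "\<sigma>\<^sup>2 = deriv (deriv b) \<psi>" and d: "d = deriv b \<psi>"
    and \<alpha>: "0 < \<alpha>" "\<alpha> < 1" and h: "h \<ge> 0" and t: "t \<ge> 0" and less: "\<alpha> < Phi (t - \<sigma> * h)"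
  shows "\<forall>\<^sub>F n in sequentially. \<forall>y\<in>{d..deriv b (\<psi> + h / sqrt n)}.
    bootstrap_quantile u \<mu> a b \<Psi> d n \<alpha> y \<le> d + \<sigma> * t / sqrt n"
  using eventually_param[OF \<psi> tendsto_const[of h]] eventually_ge_at_top[of 1]
    order_tendstoD(1)[OF cdf_mean_law_limit_fixed[OF \<psi> \<sigma> h] less]
proof eventually_elim
  case (elim n)
  show ?case
  proof
    fix y assume y: "y \<in> {d..deriv b (\<psi> + h / sqrt n)}"
    have "d \<in> mean_space b \<Psi>" "deriv b (\<psi> + h / sqrt n) \<in> mean_space b \<Psi>"
      using \<psi> elim(1) by (auto simp: mean_space_def d)
    then have "y \<in> mean_space b \<Psi>"
      using mean_space_interval y unfolding is_interval_1 by (meson atLeastAtMost_iff)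
    then obtain \<psi>' where \<psi>': "\<psi>' \<in> \<Psi>" "y = deriv b \<psi>'" by (auto simp: mean_space_def)
    then have "\<psi>' \<le> \<psi> + h / sqrt n" using y deriv_b_le_iff[OF \<psi>'(1) elim(1)] by simp
    then have "\<alpha> \<le> cdf (mean_law n \<psi>') (d + \<sigma> * t / sqrt n)"
      using cdf_mean_law_antimono[OF \<psi>'(1) elim(1) _ elim(2), of "d + \<sigma> * t / sqrt n"] elim(3)
      unfolding d by linarith
    then show "bootstrap_quantile u \<mu> a b \<Psi> d n \<alpha> y \<le> d + \<sigma> * t / sqrt n"
      unfolding \<psi>'(2) bootstrap_quantile_le_iff[OF \<psi>'(1) \<alpha>] using \<sigma>(1) t by simp
  qed
qed

lemma eventually_quantile_greater:
  assumes \<psi>: "\<psi> \<in> \<Psi>" and \<sigma>: "\<sigma> > 0" "\<sigma>\<^sup>2 = deriv (deriv b) \<psi>" and d: "d = deriv b \<psi>"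
    and \<alpha>: "0 < \<alpha>" "\<alpha> < 1" and h: "h \<ge> 0" and less: "Phi (t - \<sigma> * h) < \<alpha>"
  shows "\<forall>\<^sub>F n in sequentially. \<forall>y\<in>mean_space b \<Psi>. deriv b (\<psi> + h / sqrt n) \<le> y \<longrightarrow>
    d + \<sigma> * t / sqrt n < bootstrap_quantile u \<mu> a b \<Psi> d n \<alpha> y"
  using eventually_param[OF \<psi> tendsto_const[of h]] eventually_ge_at_top[of 1]
    order_tendstoD(2)[OF cdf_mean_law_limit_fixed[OF \<psi> \<sigma> h] less]
proof eventually_elim
  case (elim n)
  show ?case
  proof (intro ballI impI)
    fix y assume y: "y \<in> mean_space b \<Psi>" "deriv b (\<psi> + h / sqrt n) \<le> y"
    then obtain \<psi>' where \<psi>': "\<psi>' \<in> \<Psi>" "y = deriv b \<psi>'" by (auto simp: mean_space_def)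
    then have "\<psi> + h / sqrt n \<le> \<psi>'" using y deriv_b_le_iff[OF elim(1) \<psi>'(1)] by simp
    then have "\<not> \<alpha> \<le> cdf (mean_law n \<psi>') (d + \<sigma> * t / sqrt n)"
      using cdf_mean_law_antimono[OF elim(1) \<psi>'(1) _ elim(2), of "d + \<sigma> * t / sqrt n"] elim(3)
      unfolding d by linarith
    then have "\<not> bootstrap_quantile u \<mu> a b \<Psi> d n \<alpha> y \<le> d + \<sigma> * t / sqrt n"
      unfolding \<psi>'(2) bootstrap_quantile_le_iff[OF \<psi>'(1) \<alpha>] by simp
    then show "d + \<sigma> * t / sqrt n < bootstrap_quantile u \<mu> a b \<Psi> d n \<alpha> y" by simp
  qed
qed

lemma eventually_deriv_b_less:
  assumes \<psi>: "\<psi> \<in> \<Psi>" and d: "d = deriv b \<psi>"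
  shows "y * deriv (deriv b) \<psi> < \<tau> \<Longrightarrow> \<forall>\<^sub>F n in sequentially. deriv b (\<psi> + y / sqrt n) < d + \<tau> / sqrt n"
    and "\<tau> < y * deriv (deriv b) \<psi> \<Longrightarrow> \<forall>\<^sub>F n in sequentially. d + \<tau> / sqrt n < deriv b (\<psi> + y / sqrt n)"
proof -
  have iff: "sqrt (real n) * (deriv b (\<psi> + y / sqrt n) - deriv b \<psi>) < \<tau> \<longleftrightarrow> deriv b (\<psi> + y / sqrt n) < d + \<tau> / sqrt n"
    "\<tau> < sqrt (real n) * (deriv b (\<psi> + y / sqrt n) - deriv b \<psi>) \<longleftrightarrow> d + \<tau> / sqrt n < deriv b (\<psi> + y / sqrt n)"
    if "n \<ge> 1" for n using that by (simp_all add: d field_simps)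
  show "\<forall>\<^sub>F n in sequentially. deriv b (\<psi> + y / sqrt n) < d + \<tau> / sqrt n" if "y * deriv (deriv b) \<psi> < \<tau>"
    using order_tendstoD(2)[OF deriv_b_increment[OF \<psi>] that] eventually_ge_at_top[of 1]
    by eventually_elim (use iff in blast)
  show "\<forall>\<^sub>F n in sequentially. d + \<tau> / sqrt n < deriv b (\<psi> + y / sqrt n)" if "\<tau> < y * deriv (deriv b) \<psi>"
    using order_tendstoD(1)[OF deriv_b_increment[OF \<psi>] that] eventually_ge_at_top[of 1]
    by eventually_elim (use iff in blast)
qed

lemma eventually_in_mean_space:
  assumes \<psi>: "\<psi> \<in> \<Psi>" and d: "d = deriv b \<psi>"
  shows "\<forall>\<^sub>F n in sequentially. d + \<tau> / sqrt n \<in> mean_space b \<Psi>"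
proof (rule topological_tendstoD[OF _ open_mean_space])
  show "(\<lambda>n. d + \<tau> / sqrt (real n)) \<longlonglongrightarrow> d" by real_asymp
  show "d \<in> mean_space b \<Psi>" using \<psi> by (simp add: d mean_space_def)
qed

lemma natural_param_in: "\<theta> \<in> mean_space b \<Psi> \<Longrightarrow> natural_param b \<Psi> \<theta> \<in> \<Psi>"
  and deriv_b_natural_param: "\<theta> \<in> mean_space b \<Psi> \<Longrightarrow> deriv b (natural_param b \<Psi> \<theta>) = \<theta>"
  by (auto simp: mean_space_def natural_param_deriv_b)

text \<open>The derivative of the inverse function $(b')^{-1}$ at \<open>d\<close>: the local mean $d + \<tau>/\<surd>n$
has local natural parameter $\<tau>/\<sigma>^2$ in the limit.\<close>

lemma local_natural_param_limit:
  assumes \<psi>: "\<psi> \<in> \<Psi>" and d: "d = deriv b \<psi>"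
  shows "(\<lambda>n. sqrt n * (natural_param b \<Psi> (d + \<tau> / sqrt n) - \<psi>)) \<longlonglongrightarrow> \<tau> / deriv (deriv b) \<psi>"
proof (rule order_tendstoI)
  let ?v = "deriv (deriv b) \<psi>"
  have v: "?v > 0" by (rule b''_pos[OF \<psi>])
  have less: "deriv b \<psi>1 < deriv b \<psi>2 \<longleftrightarrow> \<psi>1 < \<psi>2" if "\<psi>1 \<in> \<Psi>" "\<psi>2 \<in> \<Psi>" for \<psi>1 \<psi>2
    using deriv_b_le_iff[OF that(2,1)] by linarith
  fix y
  { assume "y < \<tau> / ?v"
    then have "y * ?v < \<tau>" using v by (simp add: field_simps)
    from eventually_deriv_b_less(1)[OF \<psi> d this] eventually_in_mean_space[OF \<psi> d, of \<tau>]
      eventually_param[OF \<psi> tendsto_const[of y]] eventually_ge_at_top[of 1]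
    show "\<forall>\<^sub>F n in sequentially. y < sqrt n * (natural_param b \<Psi> (d + \<tau> / sqrt n) - \<psi>)"
    proof eventually_elim
      case (elim n)
      have "\<psi> + y / sqrt n < natural_param b \<Psi> (d + \<tau> / sqrt n)"
        using less[OF elim(3) natural_param_in[OF elim(2)]] elim(1) by (simp add: deriv_b_natural_param[OF elim(2)])
      then show ?case using elim(4) by (simp add: field_simps)
    qed }
  { assume "\<tau> / ?v < y"
    then have "\<tau> < y * ?v" using v by (simp add: field_simps)
    from eventually_deriv_b_less(2)[OF \<psi> d this] eventually_in_mean_space[OF \<psi> d, of \<tau>]
      eventually_param[OF \<psi> tendsto_const[of y]] eventually_ge_at_top[of 1]
    show "\<forall>\<^sub>F n in sequentially. sqrt n * (natural_param b \<Psi> (d + \<tau> / sqrt n) - \<psi>) < y"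
    proof eventually_elim
      case (elim n)
      have "natural_param b \<Psi> (d + \<tau> / sqrt n) < \<psi> + y / sqrt n"
        using less[OF natural_param_in[OF elim(2)] elim(3)] elim(1) by (simp add: deriv_b_natural_param[OF elim(2)])
      then show ?case using elim(4) by (simp add: field_simps)
    qed }
qed

text \<open>The data side of the problem: under the true local mean, the event that the sample mean stays below
$b'(\<psi> + h/\<surd>n)$ has the limiting probability of $Z \<le> \<sigma> h - \<tau>/\<sigma>$ for a standard
normal $Z$.\<close>

lemma cdf_mean_law_at_local_mean_limit:
  assumes \<psi>: "\<psi> \<in> \<Psi>" and \<sigma>: "\<sigma> > 0" "\<sigma>\<^sup>2 = deriv (deriv b) \<psi>" and d: "d = deriv b \<psi>" and \<tau>: "\<tau> \<ge> 0"
  shows "(\<lambda>n. cdf (mean_law n (natural_param b \<Psi> (d + \<tau> / sqrt n))) (deriv b (\<psi> + h / sqrt n)))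
    \<longlonglongrightarrow> Phi (\<sigma> * h - \<tau> / \<sigma>)"
proof -
  define h_n where "h_n n = sqrt (real n) * (natural_param b \<Psi> (d + \<tau> / sqrt n) - \<psi>)" for n
  define t_n where "t_n n = sqrt (real n) * (deriv b (\<psi> + h / sqrt n) - deriv b \<psi>) / \<sigma>" for n
  have h_lim: "h_n \<longlonglongrightarrow> \<tau> / \<sigma>\<^sup>2"
    unfolding h_n_def \<sigma>(2) by (rule local_natural_param_limit[OF \<psi> d])
  have h_nonneg: "\<forall>\<^sub>F n in sequentially. 0 \<le> h_n n"
    using eventually_in_mean_space[OF \<psi> d, of \<tau>]
  proof eventually_elim
    case (elim n)
    have "deriv b \<psi> \<le> deriv b (natural_param b \<Psi> (d + \<tau> / sqrt n))"
      unfolding deriv_b_natural_param[OF elim] using \<tau> by (simp add: d)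
    then show ?case
      using deriv_b_le_iff[OF \<psi> natural_param_in[OF elim]] by (simp add: h_n_def)
  qed
  have "t_n \<longlonglongrightarrow> h * \<sigma>\<^sup>2 / \<sigma>"
    unfolding t_n_def \<sigma>(2) using \<sigma>(1) by (intro tendsto_divide deriv_b_increment[OF \<psi>] tendsto_const) simp
  then have t_lim: "t_n \<longlonglongrightarrow> \<sigma> * h" using \<sigma>(1) by (simp add: power2_eq_square mult.commute)
  have "\<sigma> * (\<tau> / \<sigma>\<^sup>2) = \<tau> / \<sigma>" using \<sigma>(1) by (simp add: power2_eq_square)
  with cdf_mean_law_limit[OF \<psi> \<sigma> h_nonneg h_lim t_lim]
  have "(\<lambda>n. cdf (mean_law n (\<psi> + h_n n / sqrt n)) (deriv b \<psi> + \<sigma> * t_n n / sqrt n)) \<longlonglongrightarrow> Phi (\<sigma> * h - \<tau> / \<sigma>)"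
    by (simp only:)
  moreover have "\<forall>\<^sub>F n in sequentially.
      cdf (mean_law n (\<psi> + h_n n / sqrt n)) (deriv b \<psi> + \<sigma> * t_n n / sqrt n) =
      cdf (mean_law n (natural_param b \<Psi> (d + \<tau> / sqrt n))) (deriv b (\<psi> + h / sqrt n))"
    using eventually_ge_at_top[of 1] by eventually_elim (use \<sigma>(1) in \<open>simp add: h_n_def t_n_def\<close>)
  ultimately show ?thesis by (rule Lim_transform_eventually)
qed

end

section \<open>Limiting coverage\<close>

text \<open>For fixed $e$ the two bounds have different limits, with a gap that closes only as $e$ varies along
the filter \<open>F\<close>.\<close>

lemma iterated_squeeze:
  fixes f :: "nat \<Rightarrow> real"
  assumes F: "F \<noteq> bot" and L: "(L \<longlongrightarrow> c) F" and U: "(U \<longlongrightarrow> c) F"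
    and l: "\<forall>\<^sub>F e in F. l e \<longlonglongrightarrow> L e \<and> (\<forall>\<^sub>F n in sequentially. l e n \<le> f n)"
    and u: "\<forall>\<^sub>F e in F. u e \<longlonglongrightarrow> U e \<and> (\<forall>\<^sub>F n in sequentially. f n \<le> u e n)"
  shows "f \<longlonglongrightarrow> c"
proof (rule order_tendstoI)
  fix y assume "y < c"
  from eventually_happens'[OF F eventually_conj[OF order_tendstoD(1)[OF L this] l]]
  obtain e where "y < L e" "l e \<longlonglongrightarrow> L e" "\<forall>\<^sub>F n in sequentially. l e n \<le> f n" by blast
  then show "\<forall>\<^sub>F n in sequentially. y < f n"
    using order_tendstoD(1)[of "l e" "L e" sequentially y] by (auto elim: eventually_elim2)
next
  fix y assume "c < y"
  from eventually_happens'[OF F eventually_conj[OF order_tendstoD(2)[OF U this] u]]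
  obtain e where "U e < y" "u e \<longlonglongrightarrow> U e" "\<forall>\<^sub>F n in sequentially. f n \<le> u e n" by blast
  then show "\<forall>\<^sub>F n in sequentially. f n < y"
    using order_tendstoD(2)[of "u e" "U e" sequentially y] by (auto elim: eventually_elim2)
qed

context natural_exponential_family
begin

text \<open>On the scale of local natural parameters $h$ the two end points have sharp asymptotic
switches: the lower end point passes the true mean at $h_1$, where
$\<Phi>(\<tau>/\<sigma> - \<sigma> h_1) = \<alpha>_1$, and the upper one at $h_2$, where
$\<Phi>(\<tau>/\<sigma> - \<sigma> h_2) = 1 - \<alpha>_2$. If $h_2 > 0$, coverage is asymptotically the
event that the sample mean lies between $b'(\<psi> + h_2/\<surd>n)$ and $b'(\<psi> + h_1/\<surd>n)$;
if $h_2 < 0$, the truncated estimate is always to the right of the second switch and only the first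
one counts.

The bounds leave a margin $e$ around the switches. In the upper bounds the term for the tail beyond
$b'(\<psi> + 1/(e\<surd>n))$ covers the samples whose mean leaves the mean space, where the quantiles
are arbitrary: the mean space is open, so for fixed $e$ that point eventually belongs to it.\<close>

lemma percentile_coverage_limit:
  assumes \<psi>: "\<psi> \<in> \<Psi>" and \<sigma>: "\<sigma> > 0" "\<sigma>\<^sup>2 = deriv (deriv b) \<psi>" and d: "d = deriv b \<psi>" and \<tau>: "\<tau> \<ge> 0"
    and levels: "0 < \<alpha>\<^sub>1" "\<alpha>\<^sub>1 < 1 / 2" "0 < \<alpha>\<^sub>2" "\<alpha>\<^sub>2 < 1 / 2" and z2: "Phi z\<^sub>2 = 1 - \<alpha>\<^sub>2"
    and u: "\<And>n \<alpha>. u n \<alpha> \<in> borel_measurable borel"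
  defines "L \<equiv> \<lambda>n. mean_law n (natural_param b \<Psi> (d + \<tau> / sqrt (real n)))"
    and "B \<equiv> \<lambda>n. {x. d + \<tau> / sqrt (real n) \<in>
      {bootstrap_quantile u \<mu> a b \<Psi> d n \<alpha>\<^sub>1 (max x d)..bootstrap_quantile u \<mu> a b \<Psi> d n (1 - \<alpha>\<^sub>2) (max x d)}}"
  shows "z\<^sub>2 * \<sigma> < \<tau> \<Longrightarrow> (\<lambda>n. measure (L n) (B n)) \<longlonglongrightarrow> 1 - \<alpha>\<^sub>1 - \<alpha>\<^sub>2"
    and "\<tau> < z\<^sub>2 * \<sigma> \<Longrightarrow> (\<lambda>n. measure (L n) (B n)) \<longlonglongrightarrow> 1 - \<alpha>\<^sub>1"
proof -
  let ?Q = "\<lambda>n \<alpha>. bootstrap_quantile u \<mu> a b \<Psi> d n \<alpha>"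
  define S where "S n h = deriv b (\<psi> + h / sqrt (real n))" for n h
  define p where "p h n = cdf (L n) (S n h)" for h and n :: nat
  define R where "R h = Phi (\<sigma> * h - \<tau> / \<sigma>)" for h
  obtain z\<^sub>1 where z1: "Phi z\<^sub>1 = \<alpha>\<^sub>1" using Phi_surj[of \<alpha>\<^sub>1] levels by auto
  define h\<^sub>1 where "h\<^sub>1 = (\<tau> / \<sigma> - z\<^sub>1) / \<sigma>"
  define h\<^sub>2 where "h\<^sub>2 = (\<tau> / \<sigma> - z\<^sub>2) / \<sigma>"
  have h_eq: "\<tau> / \<sigma> - \<sigma> * h\<^sub>1 = z\<^sub>1" "\<tau> / \<sigma> - \<sigma> * h\<^sub>2 = z\<^sub>2" using \<sigma>(1) by (simp_all add: h\<^sub>1_def h\<^sub>2_def)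
  have Phi0: "Phi 0 = 1 / 2" using Phi_uminus[of 0] by simp
  have z_less: "z\<^sub>1 < 0" "0 < z\<^sub>2"
    using levels z1 z2 Phi0 Phi_less_iff[of z\<^sub>1 0] Phi_less_iff[of 0 z\<^sub>2] by auto
  have tau_sigma: "\<tau> / \<sigma> \<ge> 0" using \<tau> \<sigma>(1) by simp
  have h1_pos: "h\<^sub>1 > 0" and h2_less: "h\<^sub>2 < h\<^sub>1"
    using z_less tau_sigma \<sigma>(1) by (auto simp: h\<^sub>1_def h\<^sub>2_def intro!: divide_strict_right_mono)
  have R1: "R h\<^sub>1 = 1 - \<alpha>\<^sub>1" and R2: "R h\<^sub>2 = \<alpha>\<^sub>2"
  proof -
    have "\<sigma> * h\<^sub>1 - \<tau> / \<sigma> = - z\<^sub>1" "\<sigma> * h\<^sub>2 - \<tau> / \<sigma> = - z\<^sub>2" using h_eq by simp_all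
    then show "R h\<^sub>1 = 1 - \<alpha>\<^sub>1" "R h\<^sub>2 = \<alpha>\<^sub>2" by (simp_all add: R_def Phi_uminus z1 z2)
  qed
  have p_lim: "p h \<longlonglongrightarrow> R h" for h
    unfolding p_def R_def L_def S_def by (rule cdf_mean_law_at_local_mean_limit[OF \<psi> \<sigma> d \<tau>])
  have R_cont: "isCont R x" for x
    unfolding R_def by (intro isCont_o2[OF _ isCont_Phi] continuous_intros)
  have R_lim: "((\<lambda>e. R (g e)) \<longlongrightarrow> R (g 0)) (at_right 0)" if "isCont g 0" for g
    using isCont_o2[OF that R_cont] by (auto simp: isCont_def intro: filterlim_mono[OF _ order_refl at_le])
  have "LIM e at_right 0. \<sigma> * (1 / e) - \<tau> / \<sigma> :> at_top"
    using \<sigma>(1) by real_asymp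
  from filterlim_compose[OF std_normal.cdf_lim_at_top_prob this]
  have tail: "((\<lambda>e. 1 - R (1 / e)) \<longlongrightarrow> 0) (at_right 0)"
    using tendsto_diff[OF tendsto_const[of 1]] unfolding R_def by force

  have S_mem: "\<forall>\<^sub>F n in sequentially. S n h \<in> mean_space b \<Psi>" for h
    using eventually_param[OF \<psi> tendsto_const[of h]] by eventually_elim (auto simp: S_def mean_space_def)
  have S_less: "\<forall>\<^sub>F n in sequentially. S n h < S n h'" if "h < h'" for h h'
    using eventually_param[OF \<psi> tendsto_const[of h]] eventually_param[OF \<psi> tendsto_const[of h']]
      eventually_ge_at_top[of 1]
  proof eventually_elim
    case (elim n)
    have "\<psi> + h / sqrt n < \<psi> + h' / sqrt n" using elim(3) that by (simp add: divide_strict_right_mono)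
    then show ?case unfolding S_def using deriv_b_le_iff[OF elim(2,1)] by linarith
  qed
  have S0: "S n 0 = d" for n by (simp add: S_def d)
  have d_mem: "d \<in> mean_space b \<Psi>" using \<psi> by (simp add: d mean_space_def)
  have L_dist: "\<forall>\<^sub>F n in sequentially. real_distribution (L n) \<and> B n \<in> sets borel"
    using eventually_in_mean_space[OF \<psi> d, of \<tau>] eventually_ge_at_top[of 1]
  proof eventually_elim
    case (elim n)
    have [measurable]: "?Q n \<alpha>\<^sub>1 \<in> borel_measurable borel" "?Q n (1 - \<alpha>\<^sub>2) \<in> borel_measurable borel"
      using levels by (auto intro!: bootstrap_quantile_measurable elim u)
    show ?case unfolding L_def B_def atLeastAtMost_iff
      using mean_law_real_distribution[OF natural_param_in[OF elim(1)]] by simp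
  qed
  \<comment> \<open>every estimate between d and a point of the mean space is itself a possible mean\<close>
  have between: "y \<in> mean_space b \<Psi>" if "d \<le> y" "y \<le> s" "s \<in> mean_space b \<Psi>" for y s
    using mean_space_interval that d_mem unfolding is_interval_1 by blast

  have lower_ok: "\<forall>\<^sub>F n in sequentially. \<forall>y\<in>{d..S n h}. ?Q n \<alpha>\<^sub>1 y \<le> d + \<tau> / sqrt n" if "0 \<le> h" "h < h\<^sub>1" for h
  proof -
    have "z\<^sub>1 < \<tau> / \<sigma> - \<sigma> * h" using that(2) \<sigma>(1) h_eq(1) mult_strict_left_mono[of h h\<^sub>1 \<sigma>] by linarith
    then have "\<alpha>\<^sub>1 < Phi (\<tau> / \<sigma> - \<sigma> * h)" using Phi_less_iff z1 by metis
    from eventually_quantile_le[OF \<psi> \<sigma> d _ _ that(1) tau_sigma this, of u]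
    show ?thesis using levels \<sigma>(1) by (simp add: S_def)
  qed
  have lower_bad: "\<forall>\<^sub>F n in sequentially. \<forall>y\<in>mean_space b \<Psi>. S n h \<le> y \<longrightarrow> d + \<tau> / sqrt n < ?Q n \<alpha>\<^sub>1 y" if "h\<^sub>1 < h" for h
  proof -
    have "\<tau> / \<sigma> - \<sigma> * h < z\<^sub>1" using that \<sigma>(1) h_eq(1) mult_strict_left_mono[of h\<^sub>1 h \<sigma>] by linarith
    then have "Phi (\<tau> / \<sigma> - \<sigma> * h) < \<alpha>\<^sub>1" using Phi_less_iff z1 by metis
    from eventually_quantile_greater[OF \<psi> \<sigma> d _ _ _ this, of u]
    show ?thesis using levels \<sigma>(1) that h1_pos by (simp add: S_def)
  qed
  have upper_ok: "\<forall>\<^sub>F n in sequentially. \<forall>y\<in>mean_space b \<Psi>. S n h \<le> y \<longrightarrow> d + \<tau> / sqrt n < ?Q n (1 - \<alpha>\<^sub>2) y"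
    if "0 \<le> h" "h\<^sub>2 < h" for h
  proof -
    have "\<tau> / \<sigma> - \<sigma> * h < z\<^sub>2" using that(2) \<sigma>(1) h_eq(2) mult_strict_left_mono[of h\<^sub>2 h \<sigma>] by linarith
    then have "Phi (\<tau> / \<sigma> - \<sigma> * h) < 1 - \<alpha>\<^sub>2" using Phi_less_iff z2 by metis
    from eventually_quantile_greater[OF \<psi> \<sigma> d _ _ that(1) this, of u]
    show ?thesis using levels \<sigma>(1) by (simp add: S_def)
  qed
  have upper_bad: "\<forall>\<^sub>F n in sequentially. \<forall>y\<in>{d..S n h}. ?Q n (1 - \<alpha>\<^sub>2) y < d + \<tau> / sqrt n" if "0 \<le> h" "h < h\<^sub>2" for h
  proof -
    \<comment> \<open>the margin $h_2 - h$ is shared: half of it moves the evaluation point strictly below the true mean, which gives a strict inequality for the quantile\<close>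
    define \<delta> where "\<delta> = \<sigma> * (h\<^sub>2 - h) / 2"
    have \<delta>: "\<delta> > 0" using that \<sigma>(1) by (simp add: \<delta>_def)
    have eq: "\<tau> / \<sigma> - \<delta> - \<sigma> * h = z\<^sub>2 + \<delta>" using h_eq(2) by (simp add: \<delta>_def field_simps)
    have "1 - \<alpha>\<^sub>2 < Phi (\<tau> / \<sigma> - \<delta> - \<sigma> * h)" unfolding eq using Phi_less_iff[of z\<^sub>2 "z\<^sub>2 + \<delta>"] z2 \<delta> by simp
    moreover have "0 \<le> \<tau> / \<sigma> - \<delta>" using eq z_less \<delta> mult_nonneg_nonneg[of \<sigma> h] \<sigma>(1) that(1) by linarith
    ultimately have "\<forall>\<^sub>F n in sequentially. \<forall>y\<in>{d..S n h}. ?Q n (1 - \<alpha>\<^sub>2) y \<le> d + \<sigma> * (\<tau> / \<sigma> - \<delta>) / sqrt n"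
      unfolding S_def using levels by (intro eventually_quantile_le[OF \<psi> \<sigma> d _ _ that(1)]) auto
    then show ?thesis using eventually_ge_at_top[of 1]
    proof eventually_elim
      case (elim n)
      have "\<sigma> * (\<tau> / \<sigma> - \<delta>) < \<tau>" using \<sigma>(1) \<delta> by (simp add: field_simps)
      then have "d + \<sigma> * (\<tau> / \<sigma> - \<delta>) / sqrt n < d + \<tau> / sqrt n"
        using elim(2) by (simp add: divide_strict_right_mono)
      then show ?case using elim(1) by fastforce
    qed
  qed

  have p_diff: "\<forall>\<^sub>F n in sequentially. measure (L n) {S n h<..S n h'} = p h' n - p h n" if "h < h'" for h h'
    using L_dist S_less[OF that]
  proof eventually_elim
    case (elim n)
    interpret real_distribution "L n" using elim by simp
    show ?case using cdf_diff_eq[OF elim(2)] by (simp add: p_def)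
  qed
  have p_tail: "\<forall>\<^sub>F n in sequentially. measure (L n) {S n h<..} = 1 - p h n" for h
    using L_dist
  proof eventually_elim
    case (elim n)
    interpret real_distribution "L n" using elim by simp
    show ?case using prob_compl[of "{..S n h}"] by (simp add: p_def cdf_def Compl_eq_Diff_UNIV[symmetric])
  qed

  show "(\<lambda>n. measure (L n) (B n)) \<longlonglongrightarrow> 1 - \<alpha>\<^sub>1 - \<alpha>\<^sub>2" if "z\<^sub>2 * \<sigma> < \<tau>"
  proof (rule iterated_squeeze[where F = "at_right 0"])
    have h2_pos: "h\<^sub>2 > 0" using that \<sigma>(1) by (simp add: h\<^sub>2_def field_simps)
    have small: "\<forall>\<^sub>F e in at_right 0. 0 < e \<and> e < (h\<^sub>1 - h\<^sub>2) / 2 \<and> e < h\<^sub>2"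
      using h2_less h2_pos by (intro eventually_conj eventually_at_right_less order_tendstoD(2)[OF tendsto_ident_at]) auto
    show "((\<lambda>e. R (h\<^sub>1 - e) - R (h\<^sub>2 + e)) \<longlongrightarrow> 1 - \<alpha>\<^sub>1 - \<alpha>\<^sub>2) (at_right 0)"
      using tendsto_diff[OF R_lim[of "\<lambda>e. h\<^sub>1 - e"] R_lim[of "\<lambda>e. h\<^sub>2 + e"]] R1 R2 by simp
    show "((\<lambda>e. (R (h\<^sub>1 + e) - R (h\<^sub>2 - e)) + (1 - R (1 / e))) \<longlongrightarrow> 1 - \<alpha>\<^sub>1 - \<alpha>\<^sub>2) (at_right 0)"
      using tendsto_add[OF tendsto_diff[OF R_lim[of "\<lambda>e. h\<^sub>1 + e"] R_lim[of "\<lambda>e. h\<^sub>2 - e"]] tail] R1 R2 by simp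
    show "\<forall>\<^sub>F e in at_right 0. (\<lambda>n. p (h\<^sub>1 - e) n - p (h\<^sub>2 + e) n) \<longlonglongrightarrow> R (h\<^sub>1 - e) - R (h\<^sub>2 + e) \<and>
        (\<forall>\<^sub>F n in sequentially. p (h\<^sub>1 - e) n - p (h\<^sub>2 + e) n \<le> measure (L n) (B n))"
      using small
    proof (eventually_elim, intro conjI tendsto_diff p_lim)
      fix e assume e: "0 < e \<and> e < (h\<^sub>1 - h\<^sub>2) / 2 \<and> e < h\<^sub>2"
      have 1: "\<forall>\<^sub>F n in sequentially. \<forall>y\<in>{d..S n (h\<^sub>1 - e)}. ?Q n \<alpha>\<^sub>1 y \<le> d + \<tau> / sqrt n"
        using e h2_pos by (intro lower_ok) auto
      have 2: "\<forall>\<^sub>F n in sequentially. \<forall>y\<in>mean_space b \<Psi>. S n (h\<^sub>2 + e) \<le> y \<longrightarrow> d + \<tau> / sqrt n < ?Q n (1 - \<alpha>\<^sub>2) y"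
        using e h2_pos by (intro upper_ok) auto
      have 3: "\<forall>\<^sub>F n in sequentially. measure (L n) {S n (h\<^sub>2 + e)<..S n (h\<^sub>1 - e)} = p (h\<^sub>1 - e) n - p (h\<^sub>2 + e) n"
        using e by (intro p_diff) auto
      have 4: "\<forall>\<^sub>F n in sequentially. S n 0 < S n (h\<^sub>2 + e)" using e h2_pos by (intro S_less) auto
      show "\<forall>\<^sub>F n in sequentially. p (h\<^sub>1 - e) n - p (h\<^sub>2 + e) n \<le> measure (L n) (B n)"
        using 1 2 3 4 L_dist S_mem[of "h\<^sub>1 - e"]
      proof eventually_elim
        case (elim n)
        interpret real_distribution "L n" using elim by simp
        have "{S n (h\<^sub>2 + e)<..S n (h\<^sub>1 - e)} \<subseteq> B n"
        proof
          fix x assume x: "x \<in> {S n (h\<^sub>2 + e)<..S n (h\<^sub>1 - e)}"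
          then have "max x d = x" "x \<in> {d..S n (h\<^sub>1 - e)}" "x \<in> mean_space b \<Psi>"
            using elim(4,6) between[of x "S n (h\<^sub>1 - e)"] by (auto simp: S0)
          then show "x \<in> B n" using elim(1,2) x by (auto simp: B_def less_imp_le)
        qed
        then have "measure (L n) {S n (h\<^sub>2 + e)<..S n (h\<^sub>1 - e)} \<le> measure (L n) (B n)"
          using elim by (intro finite_measure_mono) auto
        then show ?case using elim(3) by simp
      qed
    qed
    show "\<forall>\<^sub>F e in at_right 0. (\<lambda>n. (p (h\<^sub>1 + e) n - p (h\<^sub>2 - e) n) + (1 - p (1 / e) n)) \<longlonglongrightarrow>
          (R (h\<^sub>1 + e) - R (h\<^sub>2 - e)) + (1 - R (1 / e)) \<and>
        (\<forall>\<^sub>F n in sequentially. measure (L n) (B n) \<le> (p (h\<^sub>1 + e) n - p (h\<^sub>2 - e) n) + (1 - p (1 / e) n))"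
      using small
    proof (eventually_elim, intro conjI tendsto_add tendsto_diff p_lim tendsto_const)
      fix e assume e: "0 < e \<and> e < (h\<^sub>1 - h\<^sub>2) / 2 \<and> e < h\<^sub>2"
      have 1: "\<forall>\<^sub>F n in sequentially. \<forall>y\<in>mean_space b \<Psi>. S n (h\<^sub>1 + e) \<le> y \<longrightarrow> d + \<tau> / sqrt n < ?Q n \<alpha>\<^sub>1 y"
        using e by (intro lower_bad) auto
      have 2: "\<forall>\<^sub>F n in sequentially. \<forall>y\<in>{d..S n (h\<^sub>2 - e)}. ?Q n (1 - \<alpha>\<^sub>2) y < d + \<tau> / sqrt n"
        using e by (intro upper_bad) auto
      have 3: "\<forall>\<^sub>F n in sequentially. measure (L n) {S n (h\<^sub>2 - e)<..S n (h\<^sub>1 + e)} = p (h\<^sub>1 + e) n - p (h\<^sub>2 - e) n"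
        using e h2_less by (intro p_diff) auto
      have 4: "\<forall>\<^sub>F n in sequentially. S n 0 < S n (h\<^sub>2 - e)" using e by (intro S_less) auto
      show "\<forall>\<^sub>F n in sequentially. measure (L n) (B n) \<le> (p (h\<^sub>1 + e) n - p (h\<^sub>2 - e) n) + (1 - p (1 / e) n)"
        using 1 2 3 4 L_dist S_mem[of "1 / e"] p_tail[of "1 / e"]
      proof eventually_elim
        case (elim n)
        interpret real_distribution "L n" using elim by simp
        have "B n \<subseteq> {S n (h\<^sub>2 - e)<..S n (h\<^sub>1 + e)} \<union> {S n (1 / e)<..}"
        proof (rule subsetI, rule ccontr)
          fix x assume x: "x \<in> B n" and "x \<notin> {S n (h\<^sub>2 - e)<..S n (h\<^sub>1 + e)} \<union> {S n (1 / e)<..}"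
          then have cases: "x \<le> S n (h\<^sub>2 - e) \<or> S n (h\<^sub>1 + e) < x" "x \<le> S n (1 / e)" by auto
          have "max x d \<in> mean_space b \<Psi>"
            using between[of x "S n (1 / e)"] cases(2) elim(6) d_mem by (auto simp: max_def)
          moreover have "max x d \<in> {d..S n (h\<^sub>2 - e)} \<or> S n (h\<^sub>1 + e) \<le> max x d"
            using cases(1) elim(4) by (auto simp: S0)
          ultimately show False using elim(1,2) x by (fastforce simp: B_def)
        qed
        then have "measure (L n) (B n) \<le> measure (L n) ({S n (h\<^sub>2 - e)<..S n (h\<^sub>1 + e)} \<union> {S n (1 / e)<..})"
          by (intro finite_measure_mono) auto
        also have "\<dots> \<le> measure (L n) {S n (h\<^sub>2 - e)<..S n (h\<^sub>1 + e)} + measure (L n) {S n (1 / e)<..}"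
          by (intro measure_Un_le) auto
        finally show ?case using elim(3,7) by simp
      qed
    qed
  qed simp

  show "(\<lambda>n. measure (L n) (B n)) \<longlonglongrightarrow> 1 - \<alpha>\<^sub>1" if "\<tau> < z\<^sub>2 * \<sigma>"
  proof (rule iterated_squeeze[where F = "at_right 0"])
    have h2_neg: "h\<^sub>2 < 0" using that \<sigma>(1) by (simp add: h\<^sub>2_def field_simps)
    have small: "\<forall>\<^sub>F e in at_right 0. 0 < e \<and> e < h\<^sub>1"
      using h1_pos by (intro eventually_conj eventually_at_right_less order_tendstoD(2)[OF tendsto_ident_at]) auto
    have 2: "\<forall>\<^sub>F n in sequentially. \<forall>y\<in>mean_space b \<Psi>. d \<le> y \<longrightarrow> d + \<tau> / sqrt n < ?Q n (1 - \<alpha>\<^sub>2) y"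
      using upper_ok[of 0] h2_neg by (simp add: S0)
    show "((\<lambda>e. R (h\<^sub>1 - e)) \<longlongrightarrow> 1 - \<alpha>\<^sub>1) (at_right 0)"
      using R_lim[of "\<lambda>e. h\<^sub>1 - e"] R1 by simp
    show "((\<lambda>e. R (h\<^sub>1 + e) + (1 - R (1 / e))) \<longlongrightarrow> 1 - \<alpha>\<^sub>1) (at_right 0)"
      using tendsto_add[OF R_lim[of "\<lambda>e. h\<^sub>1 + e"] tail] R1 by simp
    show "\<forall>\<^sub>F e in at_right 0. p (h\<^sub>1 - e) \<longlonglongrightarrow> R (h\<^sub>1 - e) \<and>
        (\<forall>\<^sub>F n in sequentially. p (h\<^sub>1 - e) n \<le> measure (L n) (B n))"
      using small
    proof (eventually_elim, intro conjI p_lim)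
      fix e assume e: "0 < e \<and> e < h\<^sub>1"
      have 1: "\<forall>\<^sub>F n in sequentially. \<forall>y\<in>{d..S n (h\<^sub>1 - e)}. ?Q n \<alpha>\<^sub>1 y \<le> d + \<tau> / sqrt n"
        using e by (intro lower_ok) auto
      have 4: "\<forall>\<^sub>F n in sequentially. S n 0 < S n (h\<^sub>1 - e)" using e by (intro S_less) auto
      show "\<forall>\<^sub>F n in sequentially. p (h\<^sub>1 - e) n \<le> measure (L n) (B n)"
        using 1 2 4 L_dist S_mem[of "h\<^sub>1 - e"]
      proof eventually_elim
        case (elim n)
        interpret real_distribution "L n" using elim by simp
        have "{..S n (h\<^sub>1 - e)} \<subseteq> B n"
        proof
          fix x assume x: "x \<in> {..S n (h\<^sub>1 - e)}"
          then have "max x d \<in> {d..S n (h\<^sub>1 - e)}" using elim(3) by (auto simp: S0)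
          moreover from this have "max x d \<in> mean_space b \<Psi>" using between[of "max x d"] elim(5) by auto
          ultimately show "x \<in> B n" using elim(1,2) by (auto simp: B_def less_imp_le)
        qed
        then show ?case unfolding p_def cdf_def using elim by (intro finite_measure_mono) auto
      qed
    qed
    show "\<forall>\<^sub>F e in at_right 0. (\<lambda>n. p (h\<^sub>1 + e) n + (1 - p (1 / e) n)) \<longlonglongrightarrow> R (h\<^sub>1 + e) + (1 - R (1 / e)) \<and>
        (\<forall>\<^sub>F n in sequentially. measure (L n) (B n) \<le> p (h\<^sub>1 + e) n + (1 - p (1 / e) n))"
      using small
    proof (eventually_elim, intro conjI tendsto_add tendsto_diff p_lim tendsto_const)
      fix e assume e: "0 < e \<and> e < h\<^sub>1"
      have 1: "\<forall>\<^sub>F n in sequentially. \<forall>y\<in>mean_space b \<Psi>. S n (h\<^sub>1 + e) \<le> y \<longrightarrow> d + \<tau> / sqrt n < ?Q n \<alpha>\<^sub>1 y"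
        using e by (intro lower_bad) auto
      show "\<forall>\<^sub>F n in sequentially. measure (L n) (B n) \<le> p (h\<^sub>1 + e) n + (1 - p (1 / e) n)"
        using 1 L_dist S_mem[of "1 / e"] p_tail[of "1 / e"]
      proof eventually_elim
        case (elim n)
        interpret real_distribution "L n" using elim by simp
        have "B n \<subseteq> {..S n (h\<^sub>1 + e)} \<union> {S n (1 / e)<..}"
        proof (rule subsetI, rule ccontr)
          fix x assume x: "x \<in> B n" and "x \<notin> {..S n (h\<^sub>1 + e)} \<union> {S n (1 / e)<..}"
          then have cases: "S n (h\<^sub>1 + e) < x" "x \<le> S n (1 / e)" by auto
          have "max x d \<in> mean_space b \<Psi>"
            using between[of x "S n (1 / e)"] cases(2) elim(3) d_mem by (auto simp: max_def)
          moreover have "S n (h\<^sub>1 + e) \<le> max x d" using cases(1) by auto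
          ultimately show False using elim(1) x by (fastforce simp: B_def)
        qed
        then have "measure (L n) (B n) \<le> measure (L n) ({..S n (h\<^sub>1 + e)} \<union> {S n (1 / e)<..})"
          by (intro finite_measure_mono) auto
        also have "\<dots> \<le> measure (L n) {..S n (h\<^sub>1 + e)} + measure (L n) {S n (1 / e)<..}"
          by (intro measure_Un_le) auto
        finally show ?case using elim(4) by (simp add: p_def cdf_def)
      qed
    qed
  qed simp
qed

end
theorem theorem2p1:
  fixes \<mu> :: "real measure" and a b :: "real \<Rightarrow> real" and \<Psi> :: "real set"
    and d \<tau> \<psi>\<^sub>0 \<sigma>\<^sub>0 \<alpha>\<^sub>1 \<alpha>\<^sub>2 :: real
    and \<theta>\<^sub>0 :: "nat \<Rightarrow> real"
    and P :: "nat \<Rightarrow> 'a measure" and X :: "nat \<Rightarrow> nat \<Rightarrow> 'a \<Rightarrow> real"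
    and u :: "nat \<Rightarrow> real \<Rightarrow> real \<Rightarrow> real"
    and \<theta>hat :: "nat \<Rightarrow> 'a \<Rightarrow> real"
    and q :: "nat \<Rightarrow> real \<Rightarrow> 'a \<Rightarrow> real"
    and coverage :: "nat \<Rightarrow> real"
  assumes family: "natural_exponential_family \<mu> a b \<Psi>"
    and boundary: "d \<in> mean_space b \<Psi>"
    and \<tau>: "\<tau> \<ge> 0"
    and \<theta>\<^sub>0: "\<And>n. \<theta>\<^sub>0 n = d + \<tau> * real n powr (- 1 / 2)"
    and \<psi>\<^sub>0: "\<psi>\<^sub>0 = natural_param b \<Psi> d"
    and \<sigma>\<^sub>0: "\<sigma>\<^sub>0 > 0" "\<sigma>\<^sub>0\<^sup>2 = deriv (deriv b) \<psi>\<^sub>0"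
    and levels: "0 < \<alpha>\<^sub>1" "\<alpha>\<^sub>1 < 1 / 2" "0 < \<alpha>\<^sub>2" "\<alpha>\<^sub>2 < 1 / 2"
    and sample: "\<And>n. n \<ge> 1 \<Longrightarrow> \<theta>\<^sub>0 n \<in> mean_space b \<Psi> \<Longrightarrow>
      random_sample (P n) n (X n) (nef_mean_dist \<mu> a b \<Psi> (\<theta>\<^sub>0 n))"
    and arbitrary_values: "\<And>n \<alpha>. u n \<alpha> \<in> borel_measurable borel"
    and \<theta>hat: "\<And>n \<omega>. \<theta>hat n \<omega> = restricted_mle d n (\<lambda>i. X n i \<omega>)"
    and q: "\<And>n \<alpha> \<omega>. q n \<alpha> \<omega> = bootstrap_quantile u \<mu> a b \<Psi> d n \<alpha> (\<theta>hat n \<omega>)"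
    and coverage: "\<And>n. coverage n =
      measure (P n) {\<omega> \<in> space (P n). \<theta>\<^sub>0 n \<in> {q n \<alpha>\<^sub>1 \<omega> .. q n (1 - \<alpha>\<^sub>2) \<omega>}}"
  shows "(\<tau> > std_normal_quantile (1 - \<alpha>\<^sub>2) * \<sigma>\<^sub>0 \<longrightarrow> coverage \<longlonglongrightarrow> 1 - \<alpha>\<^sub>1 - \<alpha>\<^sub>2) \<and>
         (\<tau> < std_normal_quantile (1 - \<alpha>\<^sub>2) * \<sigma>\<^sub>0 \<longrightarrow> coverage \<longlonglongrightarrow> 1 - \<alpha>\<^sub>1)"
proof -
  interpret natural_exponential_family \<mu> a b \<Psi> by (rule family)
  obtain \<psi> where \<psi>: "\<psi> \<in> \<Psi>" "d = deriv b \<psi>" using boundary by (auto simp: mean_space_def)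
  have \<psi>_eq: "\<psi>\<^sub>0 = \<psi>" using \<psi>\<^sub>0 natural_param_deriv_b[OF \<psi>(1)] \<psi>(2) by simp
  have \<theta>_eq: "\<theta>\<^sub>0 n = d + \<tau> / sqrt n" for n
    by (cases "n = 0") (auto simp: \<theta>\<^sub>0 powr_minus powr_half_sqrt field_simps)
  let ?L = "\<lambda>n. mean_law n (natural_param b \<Psi> (d + \<tau> / sqrt (real n)))"
  let ?B = "\<lambda>n. {x. d + \<tau> / sqrt (real n) \<in>
      {bootstrap_quantile u \<mu> a b \<Psi> d n \<alpha>\<^sub>1 (max x d)..bootstrap_quantile u \<mu> a b \<Psi> d n (1 - \<alpha>\<^sub>2) (max x d)}}"
  \<comment> \<open>the coverage event is the preimage of a Borel set under the sample mean; small n, for which the true mean may fail to be a possible mean, do not affect the limit\<close>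
  have event_eq: "\<forall>\<^sub>F n in sequentially. measure (?L n) (?B n) = coverage n"
    using eventually_in_mean_space[OF \<psi>, of \<tau>] eventually_ge_at_top[of 1]
  proof eventually_elim
    case (elim n)
    let ?X = "\<lambda>\<omega>. sample_mean n (\<lambda>i. X n i \<omega>)"
    have rs: "random_sample (P n) n (X n) (nef_dist \<mu> a b (natural_param b \<Psi> (\<theta>\<^sub>0 n)))"
      using sample[OF elim(2)] elim(1) by (simp add: \<theta>_eq nef_mean_dist_def)
    interpret P: prob_space "P n" using rs by (simp add: random_sample_def)
    have law: "distr (P n) borel ?X = ?L n"
      unfolding mean_law_def \<theta>_eq[symmetric]
      by (rule distr_sample_mean[OF rs nef_real_distribution[OF natural_param_in]]) (use elim(1) in \<open>simp add: \<theta>_eq\<close>)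
    have "X n i \<in> borel_measurable (P n)" if "i \<in> {1..n}" for i
      using rs that by (auto simp: random_sample_def P.indep_vars_def)
    then have X[measurable]: "?X \<in> borel_measurable (P n)"
      unfolding sample_mean_def by (intro borel_measurable_divide borel_measurable_sum) auto
    have [measurable]: "bootstrap_quantile u \<mu> a b \<Psi> d n \<alpha>\<^sub>1 \<in> borel_measurable borel"
      "bootstrap_quantile u \<mu> a b \<Psi> d n (1 - \<alpha>\<^sub>2) \<in> borel_measurable borel"
      using levels by (auto intro!: bootstrap_quantile_measurable elim arbitrary_values)
    have "?B n \<in> sets borel" unfolding atLeastAtMost_iff by measurable
    then have "measure (?L n) (?B n) = measure (P n) (?X -` ?B n \<inter> space (P n))"
      unfolding law[symmetric] by (rule measure_distr[OF X])
    also have "?X -` ?B n \<inter> space (P n) = {\<omega> \<in> space (P n). \<theta>\<^sub>0 n \<in> {q n \<alpha>\<^sub>1 \<omega> .. q n (1 - \<alpha>\<^sub>2) \<omega>}}"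
      by (auto simp: \<theta>_eq q \<theta>hat restricted_mle_def)
    finally show ?case by (simp add: coverage)
  qed
  have "Phi (std_normal_quantile (1 - \<alpha>\<^sub>2)) = 1 - \<alpha>\<^sub>2"
    using levels by (intro Phi_std_normal_quantile) auto
  note limits = percentile_coverage_limit
    [of \<psi> \<sigma>\<^sub>0 d \<tau> \<alpha>\<^sub>1 \<alpha>\<^sub>2, OF \<psi>(1) \<sigma>\<^sub>0[unfolded \<psi>_eq] \<psi>(2) \<tau> levels this arbitrary_values]
  show ?thesis
  proof (intro conjI impI)
    assume "std_normal_quantile (1 - \<alpha>\<^sub>2) * \<sigma>\<^sub>0 < \<tau>"
    from Lim_transform_eventually[OF limits(1)[OF this] event_eq]
    show "coverage \<longlonglongrightarrow> 1 - \<alpha>\<^sub>1 - \<alpha>\<^sub>2" .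
  next
    assume "\<tau> < std_normal_quantile (1 - \<alpha>\<^sub>2) * \<sigma>\<^sub>0"
    from Lim_transform_eventually[OF limits(2)[OF this] event_eq]
    show "coverage \<longlonglongrightarrow> 1 - \<alpha>\<^sub>1" .
  qed
qed

end
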